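(* For every prime $p>3$, $$ \sum_{k=0}^{p-1}\frac{(\frac14)_k(\frac12)_k(\frac34)_k}{k!^3\,9^k}\,(8k+1) \equiv p\biggl(\frac{-3}p\biggr)\pmod{p^3}, $$ equivalently $$ \sum_{k=0}^{p-1}\frac{\binom{4k}{2k}{\binom{2k}{k}}^2}{2^{8k}3^{2k}}\,(8k+1)\equiv p\biggl(\frac{-3}p\biggr)\pmod{p^3}. $$
   Context: $(a)_k=\prod_{j=0}^{k-1}(a+j)$ is the Pochhammer symbol. $\bigl(\frac{-3}{p}\bigr)$ is the Legendre (Jacobi--Kronecker) symbol. The left-hand side is a rational number whose denominator involves only the primes $2$ and $3$, so the congruence is understood in $\mathbb Z/p^3\mathbb Z$. *)

theory Defs
  imports "HOL-Number_Theory.Number_Theory"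
begin

text \<open>
  Rational numbers whose reduced denominator is coprime to \<open>m\<close>, i.e. the localization of the
  integers at the multiplicative set of integers coprime to \<open>m\<close>. These are exactly the rationals
  that have a well-defined residue modulo \<open>m\<close>.
\<close>

definition integral_at :: "int \<Rightarrow> rat \<Rightarrow> bool"
  where "integral_at m x \<longleftrightarrow> coprime (snd (quotient_of x)) m"

text \<open>
  Congruence of rationals modulo \<open>m\<close>: both sides have a residue modulo \<open>m\<close>, and their difference
  lies in the ideal generated by \<open>m\<close> in the localization.
\<close>

definition rat_cong :: "rat \<Rightarrow> rat \<Rightarrow> int \<Rightarrow> bool"
  where "rat_cong x y m \<longleftrightarrow>
    integral_at m x \<and> integral_at m y \<and> (\<exists>z. integral_at m z \<and> x - y = of_int m * z)"

end

theory Submission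
  imports Defs
begin

text \<open>
  The summand is \<open>(1/2)\<^sub>2\<^sub>k/(2k)! (8k + 1)\<close> times the product over \<open>j < k\<close> of the quotients of
  \<open>(1/2 + j)\<^sup>2\<close> by \<open>9 (j + 1)\<^sup>2\<close>. Deform it by replacing \<open>(1/2 + j)\<^sup>2\<close> with \<open>(1/2 + j)\<^sup>2 - A\<close> and \<open>9 (j + 1)\<^sup>2\<close> with \<open>9 (j + 1)\<^sup>2 - A\<close>. At \<open>A = p\<^sup>2/4\<close> the sum terminates
  and equals \<open>p (-3/p)\<close> exactly, by a Wilf--Zeilberger recurrence under \<open>n \<mapsto> n + 6\<close> for \<open>A = n\<^sup>2/4\<close>.
  So it suffices that the \<open>A\<close>-derivative at \<open>0\<close> vanishes modulo \<open>p\<close>, since the two values then agree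
  modulo \<open>p\<^sup>3\<close>. With \<open>p = 2 N + 1\<close>, the terms with \<open>k \<le> N\<close> are congruent to those of a sum with
  \<open>(-N)\<^sub>2\<^sub>k\<close> in place of \<open>(1/2)\<^sub>2\<^sub>k\<close> (and the denominators adjusted), which vanishes identically when \<open>N \<noteq> 1\<close> modulo \<open>3\<close>
  (a second Wilf--Zeilberger recurrence, under \<open>N \<mapsto> N + 3\<close>). The terms with \<open>k > N\<close> vanish at
  \<open>A = p\<^sup>2/4\<close>, and at \<open>A = 0\<close> they are, modulo \<open>p\<^sup>3\<close>, a common multiple of \<open>p\<^sup>2\<close> times the terms of
  the same vanishing sum with its index shifted by one half.
\<close>

section \<open>A vanishing strange hypergeometric sum\<close>

text \<open>Composes three ratio identities in cross-multiplied form, so that no division is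
  involved.\<close>

lemma mult_chain3:
  fixes c0 :: "'a :: comm_ring"
  assumes "c0 * x = c1 * u" "c1 * y = c2 * v" "c2 * z = c3 * w"
  shows "c0 * (z * y * x) = c3 * (w * v * u)"
proof -
  have "c0 * (z * y * x) = (c0 * x) * y * z" by (simp add: mult_ac)
  also have "\<dots> = (c1 * y) * u * z" unfolding assms(1) by (simp add: mult_ac)
  also have "\<dots> = (c2 * z) * u * v" unfolding assms(2) by (simp add: mult_ac)
  also have "\<dots> = c3 * (w * v * u)" unfolding assms(3) by (simp add: mult_ac)
  finally show ?thesis .
qed

lemma choose_add3:
  "of_nat (N choose m) * ((of_nat N + 3) * (of_nat N + 2) * (of_nat N + 1)) =
   of_nat ((N + 3) choose m) * ((of_nat N + 3 - of_nat m) * (of_nat N + 2 - of_nat m) * (of_nat N + 1 - of_nat m) :: rat)"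
proof -
  have *: "of_nat (n choose m) * (of_nat n + 1) = of_nat (Suc n choose m) * (of_nat n + 1 - of_nat m :: rat)" for n
  proof (cases "m \<le> Suc n")
    case True
    have "(Suc n - m) * (Suc n choose m) = Suc n * (n choose m)"
      using binomial_absorb_comp[of "Suc n" m] by simp
    from arg_cong[OF this, of "of_nat :: nat \<Rightarrow> rat"] show ?thesis
      unfolding of_nat_mult of_nat_diff[OF True] by (simp add: algebra_simps)
  qed (auto simp: binomial_eq_0)
  show ?thesis
  proof (rule mult_chain3)
    show "of_nat (N choose m) * (of_nat N + 1) = of_nat ((N + 1) choose m) * (of_nat N + 1 - of_nat m :: rat)"
    "of_nat ((N + 1) choose m) * (of_nat N + 2) = of_nat ((N + 2) choose m) * (of_nat N + 2 - of_nat m :: rat)"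
    "of_nat ((N + 2) choose m) * (of_nat N + 3) = of_nat ((N + 3) choose m) * (of_nat N + 3 - of_nat m :: rat)"
    using *[of N] *[of "N + 1"] *[of "N + 2"] by (simp_all add: eval_nat_numeral algebra_simps)
  qed
qed

lemma choose_Suc_mult:
  "of_nat (n choose Suc m) * (of_nat m + 1) = of_nat (n choose m) * (of_nat n - of_nat m :: rat)"
proof (cases "m \<le> n")
  case True
  have "Suc m * (n choose Suc m) = (n - m) * (n choose m)"
    using binomial_absorption[of m n] binomial_absorb_comp[of n m] by simp
  from arg_cong[OF this, of "of_nat :: nat \<Rightarrow> rat"] show ?thesis
    unfolding of_nat_mult of_nat_diff[OF True] by (simp add: algebra_simps)
qed (auto simp: binomial_eq_0)

lemma choose_add2:
  "of_nat (n choose (m + 2)) * ((of_nat m + 2) * (of_nat m + 1)) =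
   of_nat (n choose m) * ((of_nat n - of_nat m) * (of_nat n - of_nat m - 1) :: rat)"
proof -
  have "of_nat (n choose (m + 2)) * (of_nat m + 2) = of_nat (n choose (m + 1)) * (of_nat n - of_nat m - 1 :: rat)"
    using choose_Suc_mult[of n "m + 1"] by (simp add: algebra_simps)
  then have "(of_nat (n choose (m + 2)) * (of_nat m + 2)) * (of_nat m + 1) =
      (of_nat (n choose Suc m) * (of_nat m + 1)) * (of_nat n - of_nat m - 1 :: rat)"
    by (simp add: mult_ac)
  then show ?thesis unfolding choose_Suc_mult by (simp add: mult_ac)
qed

text \<open>
  The parameter \<open>e\<close> shifts the summation index by \<open>e/2\<close>, up to normalisation: \<open>e = 0\<close> gives the sum
  over even and \<open>e = 1\<close> the sum over odd lower binomial indices.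
\<close>

definition strange_prod :: "nat \<Rightarrow> nat \<Rightarrow> rat \<Rightarrow> nat \<Rightarrow> rat" where
  "strange_prod e N A j = (\<Prod>i<j. ((of_nat i + (1 + of_nat e) / 2)^2 - A) /
      ((3 * of_nat i + (5 + 3 * of_nat e) / 2 - of_nat N)^2 - A))"

definition strange_term :: "nat \<Rightarrow> nat \<Rightarrow> rat \<Rightarrow> nat \<Rightarrow> rat" where
  "strange_term e N A j =
     of_nat (N choose (2*j+e)) * (of_nat (4*j+2*e) - of_nat N) * strange_prod e N A j"

text \<open>Wilf--Zeilberger argument: the term at \<open>N + 3\<close> minus a multiple,
  independent of \<open>j\<close>, of the term at \<open>N\<close> is the forward difference of the
  certificate \<open>G\<close>, which vanishes at both ends of the range.\<close>

lemma strange_sum_step: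
  assumes nz: "\<And>i::nat. (3 * of_nat i + (5 + 3 * of_nat e) / 2 - of_nat (N + 3))^2 \<noteq> A"
    and K: "2 * K + e > N + 3" and e: "e \<le> 1"
    and IH: "(\<Sum>j<K. strange_term e N A j) = 0"
  shows "(\<Sum>j<K. strange_term e (N + 3) A j) = 0"
proof -
  define n where "n = (of_nat N :: rat)"
  \<comment> \<open>These are the denominator factors of the product at \<open>N + 3\<close>. Those
    at \<open>N\<close> are the same sequence advanced by one, so the two products differ only by
    the factor \<open>X j / X 0\<close>.\<close>
  define X where "X j = (3 * of_nat j + (3 * of_nat e - 1) / 2 - n)^2 - A" for j
  define W where "W = X 0"
  define Q where "Q = strange_prod e N A"
  define G where "G j = - of_nat ((N + 3) choose (2*j+e)) * of_nat (2*j+e) * (of_nat (2*j+e) - 1) * X j * Q j / ((n + 2) * W)" for j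
  have X_nz: "X j \<noteq> 0" for j
    using nz[of j] by (simp add: X_def n_def field_simps)
  have n2: "n + 2 \<noteq> 0" "n + 1 \<noteq> 0" "n + 3 \<noteq> 0" unfolding n_def by linarith+
  have Q_Suc: "Q (Suc j) * X (Suc j) = Q j * ((of_nat j + (1 + of_nat e) / 2)^2 - A)" for j
  proof -
    have "(3 * of_nat j + (5 + 3 * of_nat e) / 2 - of_nat N)^2 - A = X (Suc j)"
      by (simp add: X_def n_def field_simps)
    then show ?thesis using X_nz[of "Suc j"] unfolding Q_def strange_prod_def by simp
  qed
  have Q3: "strange_prod e (N + 3) A j = Q j * X j / W" for j
  proof (induction j)
    case 0
    show ?case using X_nz[of 0] by (simp add: Q_def strange_prod_def W_def)
  next
    case (Suc j)
    have "(3 * of_nat j + (5 + 3 * of_nat e) / 2 - of_nat (N + 3))^2 - A = X j"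
      by (simp add: X_def n_def field_simps)
    then have "strange_prod e (N + 3) A (Suc j) =
        strange_prod e (N + 3) A j * (((of_nat j + (1 + of_nat e) / 2)^2 - A) / X j)"
      unfolding strange_prod_def by simp
    also have "\<dots> = Q (Suc j) * X (Suc j) / W"
      unfolding Suc Q_Suc using X_nz[of j] by simp
    finally show ?case .
  qed
  have tele: "strange_term e (N + 3) A j - (n + 1) * (n + 3) / W * strange_term e N A j = G (Suc j) - G j" for j
  proof -
    define m where "m = (of_nat (2*j+e) :: rat)"
    define C where "C = (of_nat ((N + 3) choose (2*j+e)) :: rat)"
    have C0: "of_nat (N choose (2*j+e)) * ((n + 3) * (n + 2) * (n + 1)) = C * ((n + 3 - m) * (n + 2 - m) * (n + 1 - m))"
      unfolding C_def m_def n_def by (rule choose_add3)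
    have C2: "of_nat ((N + 3) choose (2*j+e+2)) * ((m + 2) * (m + 1)) = C * ((n + 3 - m) * (n + 2 - m))"
      using choose_add2[of "N+3" "2*j+e"] unfolding C_def m_def n_def by (simp add: algebra_simps)
    define num where "num = ((m + 1) / 2)^2 - A"
    have QX: "Q (Suc j) * X (Suc j) = Q j * num"
      unfolding Q_Suc num_def m_def by (simp add: field_simps)
    have Xj: "X j = ((3 * m - 1) / 2 - n)^2 - A"
      unfolding X_def m_def by (simp add: field_simps)
    have m': "of_nat (4 * j + 2 * e) = 2 * m" "of_nat (2 * Suc j + e) = m + 2"
      "2 * Suc j + e = 2 * j + e + 2"
      unfolding m_def by simp_all
    have "G (Suc j) = - (of_nat ((N + 3) choose (2*j+e+2)) * ((m + 2) * (m + 1))) * (Q (Suc j) * X (Suc j)) / ((n + 2) * W)"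
      unfolding G_def m' by (simp add: m_def algebra_simps)
    also have "\<dots> = - (C * ((n + 3 - m) * (n + 2 - m))) * (Q j * num) / ((n + 2) * W)"
      unfolding C2 QX ..
    finally have G1: "G (Suc j) = \<dots>" .
    have G0: "G j = - C * m * (m - 1) * X j * Q j / ((n + 2) * W)"
      unfolding G_def C_def m_def ..
    have W: "W \<noteq> 0" using X_nz[of 0] by (simp add: W_def)
    then have G1': "G (Suc j) * ((n + 2) * W) = - (C * ((n + 3 - m) * (n + 2 - m))) * (Q j * num)"
      and G0': "G j * ((n + 2) * W) = - C * m * (m - 1) * X j * Q j"
      unfolding G1 G0 using n2 by simp_all
    have f3: "strange_term e (N + 3) A j = C * (2 * m - n - 3) * (Q j * X j / W)"
      unfolding strange_term_def Q3 m' by (simp add: C_def n_def)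
    have "strange_term e N A j * ((n + 3) * (n + 2) * (n + 1)) =
        (of_nat (N choose (2*j+e)) * ((n + 3) * (n + 2) * (n + 1))) * (2 * m - n) * Q j"
      unfolding strange_term_def m' by (simp add: n_def Q_def)
    then have f0: "(n + 1) * (n + 3) * strange_term e N A j =
        C * ((n + 3 - m) * (n + 2 - m) * (n + 1 - m)) * (2 * m - n) * Q j / (n + 2)"
      unfolding C0 using n2 by (simp add: field_simps)
    \<comment> \<open>The polynomial identity that remains of the recurrence after clearing
      denominators and removing the common factor \<open>C * Q j\<close>.\<close>
    have key: "(n + 2) * (2 * m - n - 3) * X j - (n + 3 - m) * (n + 2 - m) * (n + 1 - m) * (2 * m - n)
        = m * (m - 1) * X j - (n + 3 - m) * (n + 2 - m) * num"
      unfolding Xj num_def by (simp add: field_simps power2_eq_square)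
    have "(strange_term e (N + 3) A j - (n + 1) * (n + 3) / W * strange_term e N A j) * ((n + 2) * W)
      = C * Q j * ((n + 2) * (2 * m - n - 3) * X j) - (n + 2) * ((n + 1) * (n + 3) * strange_term e N A j)"
      unfolding f3 using W by (simp add: field_simps)
    also have "\<dots> = C * Q j * ((n + 2) * (2 * m - n - 3) * X j - (n + 3 - m) * (n + 2 - m) * (n + 1 - m) * (2 * m - n))"
      unfolding f0 using n2 by (simp add: field_simps)
    also have "\<dots> = (G (Suc j) - G j) * ((n + 2) * W)"
      unfolding key left_diff_distrib[of "G (Suc j)"] G1' G0' by (simp add: algebra_simps)
    finally show ?thesis using n2 W by simp
  qed
  have "(\<Sum>j<K. strange_term e (N + 3) A j) =
      (\<Sum>j<K. G (Suc j) - G j) + (n + 1) * (n + 3) / W * (\<Sum>j<K. strange_term e N A j)"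
    unfolding tele[symmetric] sum_subtractf sum_distrib_left by simp
  also have "(\<Sum>j<K. G (Suc j) - G j) = G K - G 0"
    by (rule sum_lessThan_telescope)
  \<comment> \<open>At the upper end the lower binomial index exceeds \<open>N + 3\<close>; at the
    lower end \<open>m * (m - 1)\<close> vanishes for \<open>m = e\<close>, since \<open>e\<close>
    is 0 or 1.\<close>
  also have "G K = 0" using K by (simp add: G_def binomial_eq_0)
  also have "G 0 = 0" using e by (cases e) (auto simp: G_def)
  finally show ?thesis using IH by simp
qed

text \<open>Induction in steps of three from \<open>N = 0\<close> and \<open>N = 2\<close>. The
  third residue class is excluded because at \<open>N = 1\<close> the sum is a single term, equal to
  1 or -1.\<close>

lemma strange_sum:
  assumes "\<And>i::nat. (3 * of_nat i + (5 + 3 * of_nat e) / 2 - of_nat N)^2 \<noteq> A"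
    and "2 * K + e > N" and e: "e \<le> 1" and "N mod 3 \<noteq> 1"
  shows "(\<Sum>j<K. strange_term e N A j) = 0"
  using assms(1,2,4)
proof (induction N rule: less_induct)
  case (less N)
  consider "N = 0" | "N = 2" | "N \<ge> 3" using less.prems(3) by fastforce
  then show ?case
  proof cases
    case 1
    have "strange_term e N A j = 0" for j
      unfolding strange_term_def 1 using e by (cases "2*j+e = 0") (auto simp: binomial_eq_0)
    then show ?thesis by simp
  next
    case 2
    show ?thesis
    proof (cases "e = 0")
      case True
      \<comment> \<open>Here the only factor of the product that occurs has numerator and
        denominator both equal to \<open>1/4 - A\<close>, so the terms \<open>j = 0\<close> and
        \<open>j = 1\<close> are -2 and 2.\<close>
      have A: "A \<noteq> 1/4" using less.prems(1)[of 0] True 2 by (auto simp: power2_eq_square)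
      have "(\<Sum>j<K. strange_term e N A j) = (\<Sum>j<2. strange_term e N A j)"
      proof (rule sum.mono_neutral_right)
        show "\<forall>i\<in>{..<K} - {..<2}. strange_term e N A i = 0"
          using True 2 by (auto simp: strange_term_def binomial_eq_0)
      qed (use less.prems(2) True 2 in auto)
      also have "\<dots> = 0"
        using A True 2 by (simp add: strange_term_def strange_prod_def eval_nat_numeral field_simps)
      finally show ?thesis .
    next
      case False
      have "strange_term e N A j = 0" for j
        unfolding strange_term_def 2 using e False by (cases "j = 0") (auto simp: binomial_eq_0)
      then show ?thesis by simp
    qed
  next
    case 3
    define M where "M = N - 3"
    have M: "N = M + 3" using 3 by (simp add: M_def)
    \<comment> \<open>The denominator with index \<open>i\<close> at \<open>N - 3\<close> is the one
      with index \<open>i + 1\<close> at \<open>N\<close>, so nonvanishing descends.\<close>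
    have "(3 * of_nat i + (5 + 3 * of_nat e) / 2 - of_nat M)^2 \<noteq> A" for i
      using less.prems(1)[of "Suc i"] by (simp add: M algebra_simps)
    moreover have "2 * K + e > M" "M mod 3 \<noteq> 1" "M < N" using less.prems by (auto simp: M)
    ultimately have IH: "(\<Sum>j<K. strange_term e M A j) = 0" using less.IH by blast
    show ?thesis using strange_sum_step[OF _ _ e IH] less.prems M by simp
  qed
qed

section \<open>The deformed Ramanujan sum\<close>

definition central_ratio :: "nat \<Rightarrow> rat" where
  "central_ratio m = (\<Prod>i<m. (2 * of_nat i + 1) / (2 * (of_nat i + 1)))"

lemma central_ratio_Suc: "central_ratio (Suc m) = central_ratio m * ((2 * of_nat m + 1) / (2 * (of_nat m + 1)))"
  by (simp add: central_ratio_def)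

lemma central_ratio_eq: "central_ratio m = of_nat ((2 * m) choose m) / 4 ^ m"
proof (induction m)
  case 0
  show ?case by (simp add: central_ratio_def)
next
  case (Suc m)
  have fact: "of_nat ((2 * n) choose n) = (fact (2 * n) / (fact n * fact n) :: rat)" for n
    using binomial_fact[of n "2 * n"] by simp
  have f: "fact (2 * Suc m) = (2 * of_nat m + 2) * (2 * of_nat m + 1) * (fact (2 * m) :: rat)"
    by (simp add: algebra_simps)
  have "of_nat ((2 * Suc m) choose Suc m) = of_nat ((2 * m) choose m) * ((2 * of_nat m + 2) * (2 * of_nat m + 1)) / ((of_nat m + 1) * (of_nat m + 1) :: rat)"
    unfolding fact f by (simp add: field_simps)
  also have "\<dots> / 4 ^ Suc m = central_ratio (Suc m)"
    unfolding central_ratio_Suc Suc.IH by (simp add: divide_simps) (simp add: algebra_simps)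
  finally show ?case by simp
qed

text \<open>With \<open>A = a^2\<close> this is
  \<open>(1/2 - a)_k (1/2 + a)_k / (9^k (1 - a/3)_k (1 + a/3)_k)\<close>; pairing the factors keeps
  everything rational in \<open>A\<close>.\<close>

definition ramanujan_prod :: "rat \<Rightarrow> nat \<Rightarrow> rat" where
  "ramanujan_prod A k = (\<Prod>j<k. ((of_nat j + 1 / 2)^2 - A) / (9 * (of_nat j + 1)^2 - A))"

definition ramanujan_term :: "rat \<Rightarrow> nat \<Rightarrow> rat" where
  "ramanujan_term A k = central_ratio (2 * k) * (8 * of_nat k + 1) * ramanujan_prod A k"

lemma ramanujan_prod_0: "ramanujan_prod 0 k = (central_ratio k / 3 ^ k)^2"
proof (induction k)
  case (Suc k)
  have "ramanujan_prod 0 (Suc k) = ramanujan_prod 0 k * ((of_nat k + 1 / 2)^2 / (9 * (of_nat k + 1)^2))"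
    by (simp add: ramanujan_prod_def)
  also have "\<dots> = (central_ratio (Suc k) / 3 ^ Suc k)^2"
  proof -
    have *: "central_ratio (Suc k) / 3 ^ Suc k = central_ratio k / 3 ^ k * ((of_nat k + 1 / 2) / (3 * (of_nat k + 1)))"
      unfolding central_ratio_Suc by (simp add: divide_simps)
    show ?thesis unfolding Suc * power_mult_distrib power_divide by simp
  qed
  finally show ?case .
qed (simp add: ramanujan_prod_def central_ratio_def)

lemma ramanujan_term_0_choose:
  "of_nat (((4 * k) choose (2 * k)) * ((2 * k) choose k) ^ 2) / (2 ^ (8 * k) * 3 ^ (2 * k)) * of_nat (8 * k + 1)
    = ramanujan_term 0 k"
proof -
  have "(2::rat) ^ (8 * k) = 4 ^ (2 * k) * (4 ^ k)^2"
    using power_mult[of "2::rat" 2 "4 * k"] by (simp add: power_mult[symmetric] power_add[symmetric])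
  then show ?thesis
    unfolding ramanujan_term_def ramanujan_prod_0 central_ratio_eq
    by (simp add: power_divide power_mult_distrib power_mult[symmetric] mult_ac)
qed

lemma central_ratio_pochhammer: "central_ratio k = pochhammer (1/2) k / fact k"
proof (induction k)
  case (Suc k)
  show ?case unfolding central_ratio_Suc Suc pochhammer_Suc by (simp add: field_simps)
qed (simp add: central_ratio_def)

text \<open>Duplication formulas: \<open>(1/2)_{2k} = 4^k (1/4)_k (3/4)_k\<close> and
  \<open>(2k)! = 4^k k! (1/2)_k\<close>.\<close>

lemma central_ratio_double: "central_ratio (2 * k) * pochhammer (1/2) k = pochhammer (1/4) k * pochhammer (3/4) k / fact k"
proof (induction k)
  case (Suc k)
  have "central_ratio (2 * Suc k) * pochhammer (1/2) (Suc k) =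
     (central_ratio (2 * k) * pochhammer (1/2) k) * ((4 * of_nat k + 1) * (4 * of_nat k + 3) / (2 * (2 * of_nat k + 1) * (2 * (2 * of_nat k + 2))) * (1/2 + of_nat k))"
    using central_ratio_Suc[of "Suc (2 * k)"] central_ratio_Suc[of "2 * k"] by (simp add: pochhammer_Suc add_ac mult_ac)
  also have "(4 * of_nat k + 1) * (4 * of_nat k + 3) / (2 * (2 * of_nat k + 1) * (2 * (2 * of_nat k + 2))) * (1/2 + of_nat k)
     = ((1/4 + of_nat k) * (3/4 + of_nat k) / (of_nat k + 1) :: rat)"
  proof -
    have "2 * of_nat k + 1 \<noteq> (0::rat)" "of_nat k + 1 \<noteq> (0::rat)" by linarith+
    then show ?thesis by (simp add: divide_simps) (simp add: algebra_simps)
  qed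
  finally show ?case unfolding Suc by (simp add: pochhammer_Suc mult_ac)
qed (simp add: central_ratio_def)

lemma ramanujan_term_0_pochhammer:
  "pochhammer (1/4) k * pochhammer (1/2) k * pochhammer (3/4) k / (fact k ^ 3 * 9 ^ k) * of_nat (8 * k + 1)
    = ramanujan_term 0 k"
proof -
  have "ramanujan_term 0 k = (central_ratio (2 * k) * pochhammer (1/2) k) * pochhammer (1/2) k / (fact k ^ 2 * (3 ^ k)^2) * of_nat (8 * k + 1)"
    unfolding ramanujan_term_def ramanujan_prod_0 central_ratio_pochhammer[of k]
    by (simp add: power2_eq_square algebra_simps)
  also have "(3 ^ k)^2 = (9 ^ k :: rat)"
    by (simp add: power2_eq_square power_mult_distrib[symmetric])
  finally show ?thesis unfolding central_ratio_double
    by (simp add: power2_eq_square power3_eq_cube mult_ac)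
qed

section \<open>Exact evaluation of the terminating sums\<close>

text \<open>A Wilf--Zeilberger pair again, now under \<open>n \<mapsto> n + 6\<close>, after
  dividing the sum by \<open>n\<close>. The condition \<open>n \<noteq> 6 * i\<close> keeps all
  denominators nonzero, and \<open>a\<close> locates the zero factor that kills the certificate at
  \<open>K\<close>.\<close>

lemma ramanujan_sum_step:
  fixes n :: rat
  assumes n: "n > 0" and nz: "\<And>i::nat. n \<noteq> 6 * of_nat i"
    and a: "n + 5 = 2 * of_nat a" "a < K"
  shows "(\<Sum>k<K. ramanujan_term ((n + 6)^2 / 4) k) / (n + 6) = (\<Sum>k<K. ramanujan_term (n^2 / 4) k) / n"
proof -
  define c where "c = (1 + n) * (3 + n) * (5 + n)"
  \<comment> \<open>\<open>R\<close> takes one numerator and one denominator factor from the product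
    at \<open>n\<close> and the others from the product at \<open>n + 6\<close>, so that each of the
    two products is \<open>R\<close> times a few linear factors.\<close>
  define R where "R k = (\<Prod>j<k. (2 * of_nat j - 5 - n) * (2 * of_nat j + 1 + n) /
      ((6 * of_nat j + 6 - n) * (6 * of_nat j + 12 + n)))" for k :: nat
  define T where "T k = central_ratio (2 * k)" for k
  define G where "G k = 8 * (n + 3) / (c * n * (n + 6)) *
      ((2 * of_nat k * (2 * of_nat k - 1)) * T k) * ((6 * of_nat k - n) * (6 * of_nat k + 6 + n) * R k)" for k :: nat
  have c: "c \<noteq> 0" and n6: "n \<noteq> 0" "n + 6 \<noteq> 0" using n by (simp_all add: c_def)
  have pos: "6 * of_nat j + 6 + n \<noteq> 0" "6 * of_nat j + 12 + n \<noteq> 0" for j :: nat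
    using n of_nat_0_le_iff[of j, where ?'a = rat] by linarith+
  have neg: "6 * of_nat j - n \<noteq> 0" "6 * of_nat j + 6 - n \<noteq> 0" for j :: nat
    using nz[of j] nz[of "Suc j"] by (auto simp: algebra_simps)
  have R_Suc: "(6 * of_nat k + 6 - n) * (6 * of_nat k + 12 + n) * R (Suc k) =
      (2 * of_nat k - 5 - n) * (2 * of_nat k + 1 + n) * R k" for k
    using pos[of k] neg[of k] by (simp add: R_def)
  have T_Suc: "(2 * of_nat k + 2) * (2 * of_nat k + 1) * T (Suc k) =
      (4 * of_nat k + 1) * (4 * of_nat k + 3) / 4 * T k" for k
  proof -
    have "2 * of_nat k + 1 \<noteq> (0::rat)" "of_nat k + 1 \<noteq> (0::rat)"
      using of_nat_0_le_iff[of k, where ?'a = rat] by linarith+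
    moreover have "T (Suc k) = T k * ((2 * (2 * of_nat k) + 1) / (2 * (2 * of_nat k + 1)) *
        ((2 * (2 * of_nat k + 1) + 1) / (2 * (2 * of_nat k + 2))))"
      using central_ratio_Suc[of "Suc (2 * k)"] central_ratio_Suc[of "2 * k"] by (simp add: T_def add_ac mult_ac)
    ultimately show ?thesis by (simp add: divide_simps) (simp add: algebra_simps)
  qed
  have frac: "(x ^ 2 - m ^ 2 / 4) / (9 * y ^ 2 - m ^ 2 / 4) =
      ((2 * x - m) * (2 * x + m)) / ((6 * y - m) * (6 * y + m))" for x y m :: rat
  proof -
    have "(x ^ 2 - m ^ 2 / 4) = ((2 * x - m) * (2 * x + m)) / 4"
         "(9 * y ^ 2 - m ^ 2 / 4) = ((6 * y - m) * (6 * y + m)) / 4"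
      by (simp_all add: power2_eq_square algebra_simps)
    then show ?thesis by (simp only: divide_divide_eq_right divide_divide_eq_left times_divide_eq_left) simp
  qed
  have Q_Suc: "ramanujan_prod (m ^ 2 / 4) (Suc k) = ramanujan_prod (m ^ 2 / 4) k *
      (((2 * of_nat k + 1 - m) * (2 * of_nat k + 1 + m)) / ((6 * of_nat k + 6 - m) * (6 * of_nat k + 6 + m)))" for m k
  proof -
    have *: "2 * (of_nat k + 1 / 2) = 2 * of_nat k + (1 :: rat)" "6 * (of_nat k + 1) = 6 * of_nat k + (6 :: rat)"
      by simp_all
    show ?thesis unfolding ramanujan_prod_def prod.lessThan_Suc frac * ..
  qed
  \<comment> \<open>Passing from \<open>2j - 5 - n\<close> to \<open>2j + 1 - n\<close> shifts the
    factors by three places, and from \<open>6j + 12 + n\<close> to \<open>6j + 6 + n\<close> by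
    one, so the quotient by \<open>R\<close> telescopes to four linear factors;
    \<open>c * (n + 6)\<close> is their value at \<open>k = 0\<close> up to sign. \<open>Q6\<close>
    is analogous.\<close>
  have Q0: "ramanujan_prod (n ^ 2 / 4) k * (c * (n + 6)) =
      - R k * ((2 * of_nat k - 5 - n) * (2 * of_nat k - 3 - n) * (2 * of_nat k - 1 - n) * (6 * of_nat k + 6 + n))" for k
  proof (induction k)
    case 0
    show ?case by (simp add: ramanujan_prod_def R_def c_def algebra_simps)
  next
    case (Suc k)
    have "ramanujan_prod (n ^ 2 / 4) (Suc k) * (c * (n + 6)) =
      (ramanujan_prod (n ^ 2 / 4) k * (c * (n + 6))) * (((2 * of_nat k + 1 - n) * (2 * of_nat k + 1 + n)) / ((6 * of_nat k + 6 - n) * (6 * of_nat k + 6 + n)))"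
      unfolding Q_Suc by (simp add: mult_ac)
    also have "\<dots> = - ((2 * of_nat k - 5 - n) * (2 * of_nat k + 1 + n) * R k) *
        ((2 * of_nat k - 3 - n) * (2 * of_nat k - 1 - n) * (2 * of_nat k + 1 - n) / (6 * of_nat k + 6 - n))"
      unfolding Suc using pos[of k] neg[of k] by (simp add: mult_ac)
    also have "\<dots> = - R (Suc k) * ((2 * of_nat k - 3 - n) * (2 * of_nat k - 1 - n) * (2 * of_nat k + 1 - n) * (6 * of_nat k + 12 + n))"
      unfolding R_Suc[symmetric] using neg[of k] by (simp add: mult_ac)
    finally show ?case by (simp add: algebra_simps)
  qed
  have Q6: "ramanujan_prod ((n + 6) ^ 2 / 4) k * (c * n) =
      - R k * ((2 * of_nat k + 1 + n) * (2 * of_nat k + 3 + n) * (2 * of_nat k + 5 + n) * (6 * of_nat k - n))" for k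
  proof (induction k)
    case 0
    show ?case by (simp add: ramanujan_prod_def R_def c_def algebra_simps)
  next
    case (Suc k)
    have *: "2 * of_nat k + 1 - (n + 6) = 2 * of_nat k - 5 - n" "2 * of_nat k + 1 + (n + 6) = 2 * of_nat k + 7 + n"
      "6 * of_nat k + 6 - (n + 6) = 6 * of_nat k - n" "6 * of_nat k + 6 + (n + 6) = 6 * of_nat k + 12 + n"
      by simp_all
    have "ramanujan_prod ((n + 6) ^ 2 / 4) (Suc k) * (c * n) =
      (ramanujan_prod ((n + 6) ^ 2 / 4) k * (c * n)) * (((2 * of_nat k - 5 - n) * (2 * of_nat k + 7 + n)) / ((6 * of_nat k - n) * (6 * of_nat k + 12 + n)))"
      unfolding Q_Suc * by (simp add: mult_ac)
    also have "\<dots> = - ((2 * of_nat k - 5 - n) * (2 * of_nat k + 1 + n) * R k) *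
        ((2 * of_nat k + 3 + n) * (2 * of_nat k + 5 + n) * (2 * of_nat k + 7 + n) / (6 * of_nat k + 12 + n))"
      unfolding Suc using pos[of k] neg[of k] by (simp add: mult_ac)
    also have "\<dots> = - R (Suc k) * ((2 * of_nat k + 3 + n) * (2 * of_nat k + 5 + n) * (2 * of_nat k + 7 + n) * (6 * of_nat k + 6 - n))"
      unfolding R_Suc[symmetric] using pos[of k] by (simp add: mult_ac)
    finally show ?case by (simp add: algebra_simps)
  qed
  have tele: "ramanujan_term ((n + 6)^2 / 4) k / (n + 6) - ramanujan_term (n^2 / 4) k / n = G (Suc k) - G k" for k
  proof -
    define x where "x = (of_nat k :: rat)"
    \<comment> \<open>Multiplication by \<open>d\<close> turns both terms and both values of
      \<open>G\<close> into polynomials in \<open>x\<close> and \<open>n\<close> times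
      \<open>T k * R k\<close>, which reduces the claim to a polynomial identity.\<close>
    define d where "d = c * n * (n + 6)"
    have d: "d \<noteq> 0" using c n6 by (simp add: d_def)
    have "ramanujan_term ((n + 6)^2 / 4) k / (n + 6) * d =
        T k * (8 * x + 1) * (ramanujan_prod ((n + 6) ^ 2 / 4) k * (c * n))"
      unfolding ramanujan_term_def T_def x_def d_def using n6 by (simp add: mult_ac)
    then have f6: "ramanujan_term ((n + 6)^2 / 4) k / (n + 6) * d =
        T k * (8 * x + 1) * (- R k * ((2 * x + 1 + n) * (2 * x + 3 + n) * (2 * x + 5 + n) * (6 * x - n)))"
      unfolding Q6 x_def .
    have "ramanujan_term (n^2 / 4) k / n * d =
        T k * (8 * x + 1) * (ramanujan_prod (n ^ 2 / 4) k * (c * (n + 6)))"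
      unfolding ramanujan_term_def T_def x_def d_def using n6 by (simp add: mult_ac)
    then have f0: "ramanujan_term (n^2 / 4) k / n * d =
        T k * (8 * x + 1) * (- R k * ((2 * x - 5 - n) * (2 * x - 3 - n) * (2 * x - 1 - n) * (6 * x + 6 + n)))"
      unfolding Q0 x_def .
    have G0: "G k * d = 8 * (n + 3) * ((2 * x * (2 * x - 1)) * T k) * ((6 * x - n) * (6 * x + 6 + n) * R k)"
      using d unfolding G_def x_def d_def[symmetric] by simp
    have *: "2 * of_nat (Suc k) = 2 * of_nat k + (2 :: rat)" "2 * of_nat k + 2 - 1 = 2 * of_nat k + (1 :: rat)"
      "6 * of_nat (Suc k) - n = 6 * of_nat k + 6 - n" "6 * of_nat (Suc k) + 6 + n = 6 * of_nat k + 12 + n"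
      by simp_all
    have "G (Suc k) * d = 8 * (n + 3) * ((2 * of_nat k + 2) * (2 * of_nat k + 1) * T (Suc k)) *
        ((6 * of_nat k + 6 - n) * (6 * of_nat k + 12 + n) * R (Suc k))"
      unfolding G_def d_def[symmetric] * using d by simp
    then have G1: "G (Suc k) * d = 8 * (n + 3) * ((4 * x + 1) * (4 * x + 3) / 4 * T k) *
        ((2 * x - 5 - n) * (2 * x + 1 + n) * R k)"
      unfolding T_Suc R_Suc x_def .
    have "(ramanujan_term ((n + 6)^2 / 4) k / (n + 6) - ramanujan_term (n^2 / 4) k / n) * d = (G (Suc k) - G k) * d"
      unfolding left_diff_distrib[of "G (Suc k)"] left_diff_distrib[of _ _ d] f6 f0 G0 G1 by (simp add: field_simps)
    then show ?thesis using d by simp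
  qed
  have "(\<Sum>k<K. ramanujan_term ((n + 6)^2 / 4) k) / (n + 6) - (\<Sum>k<K. ramanujan_term (n^2 / 4) k) / n
      = (\<Sum>k<K. G (Suc k) - G k)"
    unfolding tele[symmetric] sum_subtractf sum_divide_distrib ..
  also have "\<dots> = G K - G 0"
    by (rule sum_lessThan_telescope)
  \<comment> \<open>The factor with index \<open>a\<close> contains
    \<open>2 * a - 5 - n = 0\<close>.\<close>
  also have "R K = 0" unfolding R_def using a by (intro prod_zero) (auto intro!: bexI[of _ a])
  then have "G K = 0" by (simp add: G_def)
  also have "G 0 = 0" by (simp add: G_def)
  finally show ?thesis by simp
qed

text \<open>The factor with index \<open>3 * m\<close> is zero, so the range covers every nonzero
  term. For \<open>n = 1\<close> only the term 1 survives, and the recurrence keeps the quotient by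
  \<open>n\<close> equal to 1.\<close>

lemma ramanujan_sum_1_mod_6:
  assumes "3 * m < K"
  shows "(\<Sum>k<K. ramanujan_term (of_nat (6 * m + 1)^2 / 4) k) = of_nat (6 * m + 1)"
  using assms
proof (induction m)
  case 0
  have "(\<Sum>k<K. ramanujan_term (of_nat (6 * 0 + 1)^2 / 4) k) = (\<Sum>k<1. ramanujan_term (of_nat (6 * 0 + 1)^2 / 4) k)"
  proof (rule sum.mono_neutral_right)
    show "\<forall>i\<in>{..<K} - {..<1}. ramanujan_term (of_nat (6 * 0 + 1)^2 / 4) i = 0"
      by (auto simp: ramanujan_term_def ramanujan_prod_def power2_eq_square intro!: bexI[of _ 0])
  qed (use 0 in auto)
  then show ?case by (simp add: ramanujan_term_def ramanujan_prod_def central_ratio_def)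
next
  case (Suc m)
  have "of_nat (6 * m + 1) \<noteq> (6 * of_nat i :: rat)" for i
  proof
    assume "of_nat (6 * m + 1) = (6 * of_nat i :: rat)"
    then have "of_nat (6 * m + 1) = (of_nat (6 * i) :: rat)" by simp
    then have "6 * m + 1 = 6 * i" unfolding of_nat_eq_iff .
    then show False by presburger
  qed
  moreover have "of_nat (6 * m + 1) + 5 = (2 * of_nat (3 * m + 3) :: rat)" by simp
  moreover have "3 * m + 3 < K" using Suc by simp
  ultimately have "(\<Sum>k<K. ramanujan_term ((of_nat (6 * m + 1) + 6)^2 / 4) k) / (of_nat (6 * m + 1) + 6) =
      (\<Sum>k<K. ramanujan_term (of_nat (6 * m + 1)^2 / 4) k) / of_nat (6 * m + 1)"
    by (intro ramanujan_sum_step) auto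
  also have "of_nat (6 * m + 1) + 6 = (of_nat (6 * Suc m + 1) :: rat)" by simp
  also have "(\<Sum>k<K. ramanujan_term (of_nat (6 * m + 1)^2 / 4) k) / of_nat (6 * m + 1) = 1"
    using Suc by simp
  finally show ?case by (simp add: divide_eq_eq)
qed

text \<open>Here the sign originates: for \<open>n = 5\<close> the three surviving terms add up to
  -5, and the recurrence keeps the quotient equal to -1.\<close>

lemma ramanujan_sum_5_mod_6:
  assumes "3 * m + 2 < K"
  shows "(\<Sum>k<K. ramanujan_term (of_nat (6 * m + 5)^2 / 4) k) = - of_nat (6 * m + 5)"
  using assms
proof (induction m)
  case 0
  have "(\<Sum>k<K. ramanujan_term (of_nat (6 * 0 + 5)^2 / 4) k) = (\<Sum>k<3. ramanujan_term (of_nat (6 * 0 + 5)^2 / 4) k)"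
  proof (rule sum.mono_neutral_right)
    show "\<forall>i\<in>{..<K} - {..<3}. ramanujan_term (of_nat (6 * 0 + 5)^2 / 4) i = 0"
      by (auto simp: ramanujan_term_def ramanujan_prod_def power2_eq_square intro!: bexI[of _ 2])
  qed (use 0 in auto)
  then show ?case by (simp add: ramanujan_term_def ramanujan_prod_def central_ratio_def eval_nat_numeral)
next
  case (Suc m)
  have "of_nat (6 * m + 5) \<noteq> (6 * of_nat i :: rat)" for i
  proof
    assume "of_nat (6 * m + 5) = (6 * of_nat i :: rat)"
    then have "of_nat (6 * m + 5) = (of_nat (6 * i) :: rat)" by simp
    then have "6 * m + 5 = 6 * i" unfolding of_nat_eq_iff .
    then show False by presburger
  qed
  moreover have "of_nat (6 * m + 5) + 5 = (2 * of_nat (3 * m + 5) :: rat)" by simp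
  moreover have "3 * m + 5 < K" using Suc by simp
  ultimately have "(\<Sum>k<K. ramanujan_term ((of_nat (6 * m + 5) + 6)^2 / 4) k) / (of_nat (6 * m + 5) + 6) =
      (\<Sum>k<K. ramanujan_term (of_nat (6 * m + 5)^2 / 4) k) / of_nat (6 * m + 5)"
    by (intro ramanujan_sum_step) auto
  also have "of_nat (6 * m + 5) + 6 = (of_nat (6 * Suc m + 5) :: rat)" by simp
  also have "(\<Sum>k<K. ramanujan_term (of_nat (6 * m + 5)^2 / 4) k) / of_nat (6 * m + 5) = - 1"
    using Suc by (simp del: of_nat_add of_nat_mult)
  finally show ?case by (simp add: divide_eq_eq)
qed

section \<open>Congruences of increments\<close>

text \<open>The reduced denominator divides every other denominator of the same rational, so an
  unreduced fraction is an equally good witness. The closure properties follow from this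
  form.\<close>

lemma integral_at_iff:
  "integral_at m x \<longleftrightarrow> (\<exists>a b. b \<noteq> 0 \<and> coprime b m \<and> x = of_int a / of_int b)"
proof
  assume "integral_at m x"
  then have "coprime (snd (quotient_of x)) m" by (simp add: integral_at_def)
  then show "\<exists>a b. b \<noteq> 0 \<and> coprime b m \<and> x = of_int a / of_int b"
    using quotient_of_div[of x] quotient_of_denom_pos'[of x] 
    by (intro exI[of _ "fst (quotient_of x)"] exI[of _ "snd (quotient_of x)"]) auto
next
  assume "\<exists>a b. b \<noteq> 0 \<and> coprime b m \<and> x = of_int a / of_int b"
  then obtain a b where ab: "b \<noteq> 0" "coprime b m" "x = of_int a / of_int b" by blast
  obtain c d where cd: "quotient_of x = (c, d)" by fastforce
  have "x = of_int c / of_int d" "d > 0" "coprime c d"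
    using quotient_of_div[OF cd] quotient_of_denom_pos[OF cd] quotient_of_coprime[OF cd] by auto
  then have "(of_int (c * b) :: rat) = of_int (a * d)"
    using ab by (simp add: field_simps)
  then have "c * b = a * d" by (simp only: of_int_eq_iff)
  then have "d dvd c * b" by simp
  then have "d dvd b" using \<open>coprime c d\<close> by (metis coprime_commute coprime_dvd_mult_right_iff)
  then show "integral_at m x" using ab(2) cd by (auto simp: integral_at_def intro: coprime_divisors)
qed

text \<open>Allows integrality modulo \<open>p^3\<close> to be checked modulo
  \<open>p\<close>.\<close>

lemma integral_at_power: "n > 0 \<Longrightarrow> integral_at (m ^ n) x \<longleftrightarrow> integral_at m x"
  by (simp add: integral_at_def)

lemma integral_at_of_int [simp, intro]: "integral_at m (of_int a)"
  unfolding integral_at_iff by (rule exI[of _ a], rule exI[of _ 1]) simp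

lemma integral_at_of_nat [simp, intro]: "integral_at m (of_nat a)"
  using integral_at_of_int[of m "int a"] by simp

lemma integral_at_numeral [simp, intro]: "integral_at m 0" "integral_at m 1" "integral_at m (numeral w)"
  using integral_at_of_int[of m 0] integral_at_of_int[of m 1] integral_at_of_int[of m "numeral w"] by simp_all

lemma integral_at_inverse_of_int: "coprime a m \<Longrightarrow> integral_at m (1 / of_int a)"
proof (cases "a = 0")
  case False
  then show "coprime a m \<Longrightarrow> ?thesis"
    unfolding integral_at_iff by (intro exI[of _ 1] exI[of _ a]) simp
qed simp

lemma integral_at_add [intro]:
  assumes "integral_at m x" "integral_at m y"
  shows "integral_at m (x + y)"
proof -
  obtain a b where 1: "b \<noteq> 0" "coprime b m" "x = of_int a / of_int b"
    using assms(1) by (auto simp: integral_at_iff)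
  obtain c d where 2: "d \<noteq> 0" "coprime d m" "y = of_int c / of_int d"
    using assms(2) by (auto simp: integral_at_iff)
  have "b * d \<noteq> 0 \<and> coprime (b * d) m \<and> x + y = of_int (a * d + c * b) / of_int (b * d)"
    using 1 2 by (simp add: field_simps)
  then show ?thesis unfolding integral_at_iff by blast
qed

lemma integral_at_mult [intro]:
  assumes "integral_at m x" "integral_at m y"
  shows "integral_at m (x * y)"
proof -
  obtain a b where 1: "b \<noteq> 0" "coprime b m" "x = of_int a / of_int b"
    using assms(1) by (auto simp: integral_at_iff)
  obtain c d where 2: "d \<noteq> 0" "coprime d m" "y = of_int c / of_int d"
    using assms(2) by (auto simp: integral_at_iff)
  have "b * d \<noteq> 0 \<and> coprime (b * d) m \<and> x * y = of_int (a * c) / of_int (b * d)"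
    using 1 2 by simp
  then show ?thesis unfolding integral_at_iff by blast
qed

lemma integral_at_minus [intro]: "integral_at m x \<Longrightarrow> integral_at m (- x)"
  using integral_at_mult[OF integral_at_of_int[of m "-1"], of x] by simp

lemma integral_at_diff [intro]: "integral_at m x \<Longrightarrow> integral_at m y \<Longrightarrow> integral_at m (x - y)"
  using integral_at_add[of m x "- y"] by auto

lemma integral_at_sum [intro]: "(\<And>i. i \<in> S \<Longrightarrow> integral_at m (f i)) \<Longrightarrow> integral_at m (\<Sum>i\<in>S. f i)"
  by (induction S rule: infinite_finite_induct) auto

lemma integral_at_prod [intro]: "(\<And>i. i \<in> S \<Longrightarrow> integral_at m (f i)) \<Longrightarrow> integral_at m (\<Prod>i\<in>S. f i)"
  by (induction S rule: infinite_finite_induct) auto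

lemma integral_at_pow [intro]: "integral_at m x \<Longrightarrow> integral_at m (x ^ n)"
  by (induction n) auto

lemmas integral_at_intros = integral_at_of_int integral_at_of_nat integral_at_numeral integral_at_add
  integral_at_mult integral_at_minus integral_at_diff integral_at_sum integral_at_prod integral_at_pow

text \<open>
  \<open>u\<close> and \<open>u'\<close> stand for the values of one function of \<open>A\<close> at \<open>A = 0\<close> and at some \<open>A\<close> divisible by
  \<open>m\<^sup>2\<close>, and similarly \<open>v\<close> and \<open>v'\<close>. The relation says that the two functions agree modulo \<open>m\<close> at
  \<open>0\<close> and their increments agree modulo \<open>m\<^sup>3\<close>: a substitute for congruence modulo \<open>(m, A\<^sup>2)\<close> that
  avoids derivatives.
\<close>

definition jet_cong :: "int \<Rightarrow> rat \<Rightarrow> rat \<Rightarrow> rat \<Rightarrow> rat \<Rightarrow> bool" where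
  "jet_cong m u u' v v' \<longleftrightarrow> integral_at m u \<and> integral_at m v \<and>
    (\<exists>a b c d. integral_at m a \<and> integral_at m b \<and> integral_at m c \<and> integral_at m d \<and>
      u' = u + of_int m ^ 2 * a \<and> v' = v + of_int m ^ 2 * b \<and>
      a - b = of_int m * c \<and> u - v = of_int m * d)"

lemma jet_congI:
  assumes "integral_at m u" "integral_at m v" "integral_at m a" "integral_at m b" "integral_at m c" "integral_at m d"
    "u' = u + of_int m ^ 2 * a" "v' = v + of_int m ^ 2 * b" "a - b = of_int m * c" "u - v = of_int m * d"
  shows "jet_cong m u u' v v'"
  using assms unfolding jet_cong_def by blast

lemma jet_congE:
  assumes "jet_cong m u u' v v'"
  obtains a b c d where "integral_at m u" "integral_at m v" "integral_at m a" "integral_at m b" "integral_at m c" "integral_at m d"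
    "u' = u + of_int m ^ 2 * a" "v' = v + of_int m ^ 2 * b" "a - b = of_int m * c" "u - v = of_int m * d"
  using assms unfolding jet_cong_def by blast

text \<open>For quantities independent of \<open>A\<close> both increments are 0, and only a plain
  congruence modulo \<open>m\<close> is left.\<close>

lemma jet_cong_const:
  assumes "integral_at m u" "integral_at m v" "integral_at m d" "u - v = of_int m * d"
  shows "jet_cong m u u v v"
  using assms by (intro jet_congI[of m u v 0 0 0 d]) auto

lemma jet_cong_add:
  assumes "jet_cong m u u' v v'" "jet_cong m w w' y y'"
  shows "jet_cong m (u + w) (u' + w') (v + y) (v' + y')"
proof -
  obtain a b c d where 1: "integral_at m u" "integral_at m v" "integral_at m a" "integral_at m b" "integral_at m c" "integral_at m d"
    "u' = u + of_int m ^ 2 * a" "v' = v + of_int m ^ 2 * b" "a - b = of_int m * c" "u - v = of_int m * d"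
    by (rule jet_congE[OF assms(1)])
  obtain a2 b2 c2 d2 where 2: "integral_at m w" "integral_at m y" "integral_at m a2" "integral_at m b2" "integral_at m c2" "integral_at m d2"
    "w' = w + of_int m ^ 2 * a2" "y' = y + of_int m ^ 2 * b2" "a2 - b2 = of_int m * c2" "w - y = of_int m * d2"
    by (rule jet_congE[OF assms(2)])
  show ?thesis
  proof (rule jet_congI)
    show "(a + a2) - (b + b2) = of_int m * (c + c2)" "(u + w) - (v + y) = of_int m * (d + d2)"
      using 1(9,10) 2(9,10) by (simp_all add: algebra_simps)
  qed (use 1(1-8) 2(1-8) in \<open>auto simp: algebra_simps\<close>)
qed

text \<open>The product rule: divided by \<open>m^2\<close>, the increment of a product is
  \<open>a * w + u * a2\<close> plus a multiple of \<open>m^2\<close>.\<close>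

lemma jet_cong_mult:
  assumes "jet_cong m u u' v v'" "jet_cong m w w' y y'"
  shows "jet_cong m (u * w) (u' * w') (v * y) (v' * y')"
proof -
  obtain a b c d where 1: "integral_at m u" "integral_at m v" "integral_at m a" "integral_at m b" "integral_at m c" "integral_at m d"
    "u' = u + of_int m ^ 2 * a" "v' = v + of_int m ^ 2 * b" "a - b = of_int m * c" "u - v = of_int m * d"
    by (rule jet_congE[OF assms(1)])
  obtain a2 b2 c2 d2 where 2: "integral_at m w" "integral_at m y" "integral_at m a2" "integral_at m b2" "integral_at m c2" "integral_at m d2"
    "w' = w + of_int m ^ 2 * a2" "y' = y + of_int m ^ 2 * b2" "a2 - b2 = of_int m * c2" "w - y = of_int m * d2"
    by (rule jet_congE[OF assms(2)])
  define M where "M = (of_int m :: rat)"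
  have M: "integral_at m M" by (simp add: M_def)
  show ?thesis
  proof (rule jet_congI)
    show "u' * w' = u * w + of_int m ^ 2 * (a * w + u * a2 + M^2 * a * a2)"
      "v' * y' = v * y + of_int m ^ 2 * (b * y + v * b2 + M^2 * b * b2)"
      unfolding 1(7,8) 2(7,8) M_def by (simp_all add: algebra_simps power2_eq_square)
    \<comment> \<open>Factors are exchanged one at a time, so that each summand contains a
      difference known to be divisible by \<open>m\<close>.\<close>
    have "(a * w + u * a2 + M^2 * a * a2) - (b * y + v * b2 + M^2 * b * b2) =
       a * (w - y) + (a - b) * y + u * (a2 - b2) + (u - v) * b2 + M^2 * (a * a2 - b * b2)"
      by (simp add: algebra_simps)
    also have "\<dots> = of_int m * (a * d2 + c * y + u * c2 + d * b2 + M * (a * a2 - b * b2))"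
      unfolding 1 2 M_def by (simp add: algebra_simps power2_eq_square)
    finally show "(a * w + u * a2 + M^2 * a * a2) - (b * y + v * b2 + M^2 * b * b2) =
       of_int m * (a * d2 + c * y + u * c2 + d * b2 + M * (a * a2 - b * b2))" .
    have "u * w - v * y = (u - v) * w + v * (w - y)" by (simp add: algebra_simps)
    also have "\<dots> = of_int m * (d * w + v * d2)" unfolding 1 2 by (simp add: algebra_simps)
    finally show "u * w - v * y = of_int m * (d * w + v * d2)" .
  qed (intro integral_at_intros 1(1-6) 2(1-6) M)+
qed

lemma jet_cong_inverse:
  assumes "jet_cong m u u' v v'" and nz: "u \<noteq> 0" "u' \<noteq> 0" "v \<noteq> 0" "v' \<noteq> 0"
    and int: "integral_at m (1 / u)" "integral_at m (1 / u')" "integral_at m (1 / v)" "integral_at m (1 / v')"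
  shows "jet_cong m (1 / u) (1 / u') (1 / v) (1 / v')"
proof -
  obtain a b c d where 1: "integral_at m u" "integral_at m v" "integral_at m a" "integral_at m b" "integral_at m c" "integral_at m d"
    "u' = u + of_int m ^ 2 * a" "v' = v + of_int m ^ 2 * b" "a - b = of_int m * c" "u - v = of_int m * d"
    by (rule jet_congE[OF assms(1)])
  define M where "M = (of_int m :: rat)"
  have M: "integral_at m M" by (simp add: M_def)
  define U U' V V' where UV: "U = 1 / u" "U' = 1 / u'" "V = 1 / v" "V' = 1 / v'"
  have inv: "U * u = 1" "U' * u' = 1" "V * v = 1" "V' * v' = 1" using nz by (simp_all add: UV)
  have int': "integral_at m U" "integral_at m U'" "integral_at m V" "integral_at m V'"
    using int by (simp_all add: UV)
  have "jet_cong m U U' V V'"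
  proof (rule jet_congI)
    \<comment> \<open>The increment of a reciprocal:
      \<open>1/u' - 1/u = - (u' - u) / (u * u')\<close>.\<close>
    have "U' - U = U' * (U * u) - U * (U' * u')" unfolding inv by simp
    also have "\<dots> = of_int m ^ 2 * (- (a * U * U'))" unfolding 1(7) by (simp add: algebra_simps)
    finally show "U' = U + of_int m ^ 2 * (- (a * U * U'))" by (simp add: algebra_simps)
    have "V' - V = V' * (V * v) - V * (V' * v')" unfolding inv by simp
    also have "\<dots> = of_int m ^ 2 * (- (b * V * V'))" unfolding 1(8) by (simp add: algebra_simps)
    finally show "V' = V + of_int m ^ 2 * (- (b * V * V'))" by (simp add: algebra_simps)
    have "U - V = U * (V * v) - V * (U * u)" unfolding inv by simp
    also have "\<dots> = - (U * V) * (u - v)" by (simp add: algebra_simps)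
    finally have d: "U - V = of_int m * (- (U * V) * d)" unfolding 1(10) by (simp add: algebra_simps)
    then show "U - V = of_int m * (- (U * V) * d)" .
    \<comment> \<open>The increments of the reciprocals involve \<open>U'\<close> and
      \<open>V'\<close>, so these must be compared modulo \<open>m\<close> as well.\<close>
    have "U' - V' = U' * (V' * v') - V' * (U' * u')" unfolding inv by simp
    also have "\<dots> = - (U' * V') * (u' - v')" by (simp add: algebra_simps)
    also have "u' - v' = (u - v) + M^2 * (a - b)" unfolding 1(7,8) M_def by (simp add: algebra_simps)
    also have "\<dots> = M * (d + M^2 * c)" unfolding 1(9,10) M_def by (simp add: algebra_simps power2_eq_square)
    finally have d': "U' - V' = M * (- (U' * V') * (d + M^2 * c))" by simp
    have "- (a * U * U') - - (b * V * V') = - (a - b) * V * V' - a * ((U - V) * V') - a * U * (U' - V')"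
      by (simp add: algebra_simps)
    also have "\<dots> = of_int m * (- c * V * V' - a * ((- (U * V) * d) * V') - a * U * (- (U' * V') * (d + M^2 * c)))"
      unfolding d d' 1(9) M_def by (simp add: algebra_simps)
    finally show "- (a * U * U') - - (b * V * V') =
      of_int m * (- c * V * V' - a * ((- (U * V) * d) * V') - a * U * (- (U' * V') * (d + M^2 * c)))" .
  qed (intro integral_at_intros 1(1-6) int' M)+
  then show ?thesis unfolding UV .
qed

lemma jet_cong_0: "jet_cong m 0 0 0 0" and jet_cong_1: "jet_cong m 1 1 1 1"
  by (auto intro!: jet_cong_const[of m _ _ 0])

lemma jet_cong_sum:
  "(\<And>i. i \<in> S \<Longrightarrow> jet_cong m (u i) (u' i) (v i) (v' i)) \<Longrightarrow>
    jet_cong m (\<Sum>i\<in>S. u i) (\<Sum>i\<in>S. u' i) (\<Sum>i\<in>S. v i) (\<Sum>i\<in>S. v' i)"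
  by (induction S rule: infinite_finite_induct) (auto intro: jet_cong_add jet_cong_0)

lemma jet_cong_prod:
  "(\<And>i. i \<in> S \<Longrightarrow> jet_cong m (u i) (u' i) (v i) (v' i)) \<Longrightarrow>
    jet_cong m (\<Prod>i\<in>S. u i) (\<Prod>i\<in>S. u' i) (\<Prod>i\<in>S. v i) (\<Prod>i\<in>S. v' i)"
  by (induction S rule: infinite_finite_induct) (auto intro: jet_cong_mult jet_cong_1)

lemma jet_cong_diff:
  assumes "jet_cong m u u' v v'" "jet_cong m w w' y y'"
  shows "jet_cong m (u - w) (u' - w') (v - y) (v' - y')"
proof -
  have "jet_cong m (-1 * w) (-1 * w') (-1 * y) (-1 * y')"
    by (rule jet_cong_mult[OF jet_cong_const[where d = 0] assms(2)]) (auto intro: integral_at_minus)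
  from jet_cong_add[OF assms(1) this] show ?thesis by simp
qed

section \<open>Units of the localization and division of increments\<close>

definition unit_at :: "int \<Rightarrow> rat \<Rightarrow> bool" where
  "unit_at m x \<longleftrightarrow> x \<noteq> 0 \<and> integral_at m x \<and> integral_at m (1 / x)"

lemma unit_at_of_int:
  assumes "coprime a m" "m > 1"
  shows "unit_at m (of_int a)"
proof -
  have "a \<noteq> 0" using assms coprime_0_left_iff[of m] by auto
  then show ?thesis using assms by (auto simp: unit_at_def intro: integral_at_inverse_of_int)
qed

lemma unit_at_mult:
  assumes "unit_at m x" "unit_at m y"
  shows "unit_at m (x * y)"
proof -
  have "1 / (x * y) = (1 / x) * (1 / y)" by simp
  then show ?thesis using assms unfolding unit_at_def by (metis integral_at_mult mult_eq_0_iff)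
qed

lemma unit_at_power: "unit_at m x \<Longrightarrow> unit_at m (x ^ n)"
  by (induction n) (auto simp: unit_at_mult, simp add: unit_at_def)

text \<open>Factoring out \<open>x\<close> leaves \<open>1 + m * a / b = (b + a * m) / b\<close>
  with \<open>d / x = a / b\<close>, and \<open>b + a * m\<close> is coprime to \<open>m\<close>
  because \<open>b\<close> is.\<close>

lemma unit_at_add:
  assumes "unit_at m x" "integral_at m d" "m > 1"
  shows "unit_at m (x + of_int m * d)"
proof -
  define V where "V = 1 / x"
  have V: "integral_at m V" "x \<noteq> 0" using assms by (auto simp: V_def unit_at_def)
  have "integral_at m (V * d)" using V assms by auto
  then obtain a b where ab: "b \<noteq> 0" "coprime b m" "V * d = of_int a / of_int b"
    by (auto simp: integral_at_iff)
  have "coprime (b + a * m) m" using ab(2) by (simp add: coprime_iff_gcd_eq_1 gcd.commute[of _ m] gcd_add_mult add.commute[of b])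
  then have u: "unit_at m (of_int (b + a * m))" using assms by (intro unit_at_of_int)
  have "x + of_int m * d = x * (1 + of_int m * (V * d))"
    using V(2) by (simp add: V_def field_simps)
  also have "1 + of_int m * (V * d) = of_int (b + a * m) * (1 / of_int b)"
    unfolding ab(3) using ab(1) by (simp add: field_simps)
  finally have eq: "x + of_int m * d = x * (of_int (b + a * m) * (1 / of_int b))" .
  have "unit_at m (1 / of_int b)"
    using ab by (auto simp: unit_at_def intro: integral_at_inverse_of_int)
  then show ?thesis unfolding eq using u assms(1) by (intro unit_at_mult)
qed

text \<open>The remaining denominators \<open>w'\<close>, \<open>y\<close> and \<open>y'\<close>
  differ from the unit \<open>w\<close> by multiples of \<open>m\<close>, hence are units
  too.\<close>

lemma jet_cong_divide:
  assumes "jet_cong m u u' v v'" "jet_cong m w w' y y'" "unit_at m w" "m > 1"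
  shows "jet_cong m (u / w) (u' / w') (v / y) (v' / y')"
proof -
  obtain a b c d where 1: "integral_at m w" "integral_at m y" "integral_at m a" "integral_at m b" "integral_at m c" "integral_at m d"
    "w' = w + of_int m ^ 2 * a" "y' = y + of_int m ^ 2 * b" "a - b = of_int m * c" "w - y = of_int m * d"
    by (rule jet_congE[OF assms(2)])
  have "unit_at m (w + of_int m * (of_int m * a))"
    by (intro unit_at_add assms integral_at_intros 1)
  then have "unit_at m w'" unfolding 1(7) by (simp add: power2_eq_square mult.assoc)
  have "unit_at m (w + of_int m * (- d))"
    by (intro unit_at_add assms integral_at_intros 1)
  also have "w + of_int m * (- d) = y" using 1(10) by simp
  finally have "unit_at m y" .
  then have "unit_at m (y + of_int m * (of_int m * b))"
    by (intro unit_at_add assms integral_at_intros 1)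
  then have "unit_at m y'" unfolding 1(8) by (simp add: power2_eq_square mult.assoc)
  have "jet_cong m (1 / w) (1 / w') (1 / y) (1 / y')"
    using \<open>unit_at m y\<close> \<open>unit_at m y'\<close> \<open>unit_at m w'\<close> assms
    by (intro jet_cong_inverse) (auto simp: unit_at_def)
  from jet_cong_mult[OF assms(1) this] show ?thesis by simp
qed

section \<open>The supercongruence\<close>

text \<open>Euler's criterion for -3 and for 3 gives \<open>(-3/p) = (-1)^N (3/p)\<close>,
  reciprocity turns this into \<open>(p/3)\<close>, and Euler's criterion modulo 3 evaluates
  it.\<close>

lemma Legendre_minus_3:
  fixes p :: nat
  assumes "prime p" "p > 3"
  shows "Legendre (-3) (int p) = (if p mod 3 = 1 then 1 else -1)"
proof -
  define N where "N = (p - 1) div 2"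
  have p3: "\<not> 3 dvd p"
    using assms primes_dvd_imp_eq[of 3 p] by auto
  \<comment> \<open>Two values among -1, 0, 1 differ by at most 2, which is less than the
    modulus.\<close>
  have cong_eq: "a = b" if "[a = b] (mod int q)" "a \<in> {-1,0,1}" "b \<in> {-1,0,1}" "q > 2" for a b :: int and q
  proof -
    have "int q dvd a - b" using that(1) by (simp add: cong_iff_dvd_diff)
    moreover have "\<bar>a - b\<bar> < int q" using that(2-4) by auto
    ultimately have "a - b = 0" using dvd_imp_le_int[of "a - b" "int q"] by linarith
    then show ?thesis by simp
  qed
  have L: "Legendre a q \<in> {-1,0,1}" for a q by (simp add: Legendre_def)
  have "[Legendre (-3) (int p) = (-3) ^ N] (mod int p)"
    using euler_criterion[of p "-3"] assms by (simp add: N_def)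
  also have "(-3) ^ N = (-1) ^ N * (3 :: int) ^ N"
    by (simp add: power_mult_distrib[symmetric])
  also have "[\<dots> = (-1) ^ N * Legendre 3 (int p)] (mod int p)"
    using euler_criterion[of p 3] assms by (intro cong_scalar_left) (simp add: N_def cong_sym)
  also have "(-1) ^ N * Legendre 3 (int p) = Legendre (int p) 3"
  proof -
    have "Legendre (int p) 3 * Legendre 3 (int p) = (-1) ^ N"
      using Quadratic_Reciprocity[of p 3] assms by (simp add: N_def)
    then show ?thesis using L[of "int p" 3] L[of 3 "int p"]
      by (cases "even N") auto
  qed
  finally have "Legendre (-3) (int p) = Legendre (int p) 3"
    using L assms by (intro cong_eq) auto
  also have "\<dots> = (if p mod 3 = 1 then 1 else -1)"
  proof (rule cong_eq[of _ _ 3])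
    have "[Legendre (int p) (int 3) = int p ^ 1] (mod int 3)"
      using euler_criterion[of 3 "int p"] by simp
    also have "[int p ^ 1 = (if p mod 3 = 1 then 1 else -1)] (mod int 3)"
    proof (cases "p mod 3 = 1")
      case True
      then have "int p mod 3 = 1" by presburger
      then show ?thesis using True by (simp add: cong_def)
    next
      case False
      then have "p mod 3 = 2" using p3 by presburger
      then have "int p mod 3 = 2" by presburger
      then show ?thesis using False by (simp add: cong_def)
    qed
    finally show "[Legendre (int p) 3 = (if p mod 3 = 1 then 1 else -1)] (mod int 3)" by simp
  qed (use L in auto)
  finally show ?thesis .
qed

text \<open>The signed binomial coefficient as \<open>(-N)_r / r!\<close>, ready for a factorwise
  comparison with \<open>central_ratio\<close>.\<close>

lemma choose_eq_prod:
  "(-1) ^ r * of_nat (N choose r) = (\<Prod>i<r. (of_nat i - of_nat N) / (of_nat i + 1 :: rat))"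
proof (induction r)
  case (Suc r)
  have "of_nat r + 1 \<noteq> (0 :: rat)" by linarith
  then have *: "of_nat (N choose Suc r) = of_nat (N choose r) * (of_nat N - of_nat r) / (of_nat r + 1 :: rat)"
    using choose_Suc_mult[of N r] by (simp add: field_simps)
  show ?case unfolding * prod.lessThan_Suc Suc[symmetric] by (simp add: field_simps)
qed simp

lemma central_ratio_add:
  "central_ratio (s + r) = central_ratio s *
     (\<Prod>i<r. (2 * (of_nat s + of_nat i) + 1) / (2 * (of_nat s + of_nat i + 1)))"
  by (induction r) (simp_all add: central_ratio_Suc)

context
  fixes p N :: nat
  assumes prime: "prime p" and p_gt: "p > 3" and p_eq: "p = 2 * N + 1"
begin

lemma p_gt_1: "int p > 1" using p_gt by simp

lemma unit_lt:
  assumes "0 < i" "i < p"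
  shows "unit_at (int p) (of_nat i)"
proof -
  have "coprime p i" using assms prime by (intro prime_imp_coprime) (auto dest: dvd_imp_le)
  then have "coprime (int i) (int p)" by (simp add: coprime_commute)
  from unit_at_of_int[OF this p_gt_1] show ?thesis by simp
qed

lemma unit_numeral: "unit_at (int p) 2" "unit_at (int p) 3" "unit_at (int p) 4"
proof -
  show 2: "unit_at (int p) 2" "unit_at (int p) 3" using unit_lt[of 2] unit_lt[of 3] p_gt by auto
  show "unit_at (int p) 4" using unit_at_mult[OF 2(1) 2(1)] by simp
qed

lemma integral_half: "integral_at (int p) (1 / 2)" "integral_at (int p) (1 / 4)"
  using unit_numeral by (auto simp: unit_at_def)

lemma of_nat_p: "of_nat p = 2 * of_nat N + (1 :: rat)"
  by (simp add: p_eq)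

text \<open>The residue that \<open>strange_sum\<close> excludes would make 3 divide
  \<open>p\<close>.\<close>

lemma N_mod_3: "N mod 3 \<noteq> 1"
proof
  assume "N mod 3 = 1"
  then have "3 dvd p" unfolding p_eq by presburger
  then show False using primes_dvd_imp_eq[of 3 p] prime p_gt by auto
qed

lemma jet_param: "jet_cong (int p) 0 (of_nat p ^ 2 / 4) 0 (of_nat p ^ 2 / 4)"
  by (rule jet_congI[of _ 0 0 "1/4" "1/4" 0 0]) (auto intro: integral_half)

lemma jet_const: "u - v = of_nat p * d \<Longrightarrow> integral_at (int p) u \<Longrightarrow> integral_at (int p) v \<Longrightarrow>
    integral_at (int p) d \<Longrightarrow> jet_cong (int p) u u v v"
  by (rule jet_cong_const[of _ _ _ d]) auto

lemma integral_central_ratio: "integral_at (int p) (central_ratio m)"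
proof -
  have "central_ratio m = of_nat ((2 * m) choose m) * (1 / 4 ^ m)"
    by (simp add: central_ratio_eq)
  moreover have "integral_at (int p) (1 / 4 ^ m)"
    using unit_at_power[OF unit_numeral(3), of m] by (simp add: unit_at_def)
  ultimately show ?thesis by (metis integral_at_mult integral_at_of_nat)
qed

lemma integral_ramanujan_prod_0: "integral_at (int p) (ramanujan_prod 0 k)"
proof -
  have "ramanujan_prod 0 k = (central_ratio k * (1 / 3 ^ k))^2"
    by (simp add: ramanujan_prod_0)
  moreover have "integral_at (int p) (1 / 3 ^ k)"
    using unit_at_power[OF unit_numeral(2), of k] by (simp add: unit_at_def)
  ultimately show ?thesis using integral_central_ratio by (metis integral_at_mult integral_at_pow)
qed

lemma integral_ramanujan_term_0: "integral_at (int p) (ramanujan_term 0 k)"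
  unfolding ramanujan_term_def
  by (intro integral_at_intros integral_central_ratio integral_ramanujan_prod_0)

section \<open>Termwise comparison with the vanishing sums\<close>

text \<open>Modulo \<open>p\<close>, \<open>2 * N\<close> is -1, so \<open>2 * i + 1\<close> becomes
  \<open>2 * (i - N)\<close>, and the offset \<open>p * t\<close> disappears. The lower half of the
  sum uses \<open>t = 0\<close>, the upper half \<open>t = 1\<close>.\<close>

lemma jet_choose:
  fixes t :: nat
  assumes "r < p"
  defines "f \<equiv> (\<Prod>i<r. (2 * (of_nat (p * t) + of_nat i) + 1) / (2 * (of_nat (p * t) + of_nat i + 1)))"
  shows "jet_cong (int p) f f ((-1) ^ r * of_nat (N choose r)) ((-1) ^ r * of_nat (N choose r))"
  unfolding f_def choose_eq_prod
proof (rule jet_cong_prod)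
  fix i assume "i \<in> {..<r}"
  then have i: "i < r" by simp
  have unit: "unit_at (int p) (2 * (of_nat (p * t) + of_nat i + 1))"
  proof -
    have "unit_at (int p) (2 * (of_nat (i + 1) + of_int (int p) * of_nat t))"
      using i assms(1) by (intro unit_at_mult unit_at_add unit_numeral unit_lt integral_at_intros p_gt_1) auto
    then show ?thesis by (simp add: algebra_simps)
  qed
  have *: "(of_nat i - of_nat N) / (of_nat i + 1) = (2 * of_nat i - 2 * of_nat N) / (2 * (of_nat i + 1 :: rat))"
    by (simp only: right_diff_distrib[symmetric] mult_divide_mult_cancel_left_if) simp
  show "jet_cong (int p) ((2 * (of_nat (p * t) + of_nat i) + 1) / (2 * (of_nat (p * t) + of_nat i + 1)))
        ((2 * (of_nat (p * t) + of_nat i) + 1) / (2 * (of_nat (p * t) + of_nat i + 1)))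
       ((of_nat i - of_nat N) / (of_nat i + 1)) ((of_nat i - of_nat N) / (of_nat i + 1))"
    unfolding *
  proof (rule jet_cong_divide[OF _ _ unit p_gt_1])
    show "jet_cong (int p) (2 * (of_nat (p * t) + of_nat i) + 1) (2 * (of_nat (p * t) + of_nat i) + 1)
       (2 * of_nat i - 2 * of_nat N) (2 * of_nat i - 2 * of_nat N)"
      by (rule jet_const[of _ _ "2 * of_nat t + 1"]) 
         (simp add: of_nat_p algebra_simps, (intro integral_at_intros)+)
    show "jet_cong (int p) (2 * (of_nat (p * t) + of_nat i + 1)) (2 * (of_nat (p * t) + of_nat i + 1))
       (2 * (of_nat i + 1)) (2 * (of_nat i + 1))"
      by (rule jet_const[of _ _ "2 * of_nat t"]) 
         (simp add: algebra_simps, (intro integral_at_intros)+)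
  qed
qed

text \<open>The numerators coincide. In the denominators \<open>3 * (j + 1)\<close> and
  \<open>3 * j + 5/2 - N\<close> differ by \<open>p / 2\<close>; they are squared and the same
  \<open>A\<close> is subtracted from both.\<close>

lemma jet_ramanujan_prod:
  assumes "k < p"
  shows "jet_cong (int p) (ramanujan_prod 0 k) (ramanujan_prod (of_nat p ^ 2 / 4) k)
           (strange_prod 0 N 0 k) (strange_prod 0 N (of_nat p ^ 2 / 4) k)"
  unfolding ramanujan_prod_def strange_prod_def
proof (rule jet_cong_prod, rule jet_cong_divide[OF _ _ _ p_gt_1])
  fix j assume "j \<in> {..<k}"
  then have j: "j + 1 < p" using assms by simp
  have half: "integral_at (int p) (of_nat j + 1 / 2)"
    by (intro integral_at_intros integral_half)
  show "jet_cong (int p) ((of_nat j + 1 / 2)\<^sup>2 - 0) ((of_nat j + 1 / 2)\<^sup>2 - of_nat p ^ 2 / 4)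
      ((of_nat j + (1 + of_nat 0) / 2)\<^sup>2 - 0) ((of_nat j + (1 + of_nat 0) / 2)\<^sup>2 - of_nat p ^ 2 / 4)"
    by (rule jet_cong_diff[OF jet_const[of _ _ 0] jet_param]) (use half in auto)
  have "jet_cong (int p) (3 * (of_nat j + 1)) (3 * (of_nat j + 1))
      (3 * of_nat j + (5 + 3 * of_nat 0) / 2 - of_nat N) (3 * of_nat j + (5 + 3 * of_nat 0) / 2 - of_nat N)"
  proof (rule jet_const[of _ _ "1 / 2"])
    have "integral_at (int p) (3 * of_nat j + 5 * (1 / 2) - of_nat N)"
      by (intro integral_at_intros integral_half)
    then show "integral_at (int p) (3 * of_nat j + (5 + 3 * of_nat 0) / 2 - of_nat N)" by simp
    show "integral_at (int p) (3 * (of_nat j + 1))" by (intro integral_at_intros)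
  qed (use integral_half in \<open>simp_all add: of_nat_p field_simps\<close>)
  from jet_cong_diff[OF jet_cong_mult[OF this this] jet_param]
  show "jet_cong (int p) (9 * (of_nat j + 1)\<^sup>2 - 0) (9 * (of_nat j + 1)\<^sup>2 - of_nat p ^ 2 / 4)
      ((3 * of_nat j + (5 + 3 * of_nat 0) / 2 - of_nat N)\<^sup>2 - 0)
      ((3 * of_nat j + (5 + 3 * of_nat 0) / 2 - of_nat N)\<^sup>2 - of_nat p ^ 2 / 4)"
    by (simp add: power2_eq_square algebra_simps)
  have "unit_at (int p) ((3 * of_nat (j + 1))^2)"
    using j by (intro unit_at_power unit_at_mult unit_numeral unit_lt) auto
  also have "(3 * of_nat (j + 1))^2 = 9 * (of_nat j + 1)\<^sup>2 - (0 :: rat)"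
    unfolding power_mult_distrib by simp
  finally show "unit_at (int p) (9 * (of_nat j + 1)\<^sup>2 - 0)" .
qed

text \<open>The linear factors satisfy \<open>8 * k + 1 = 2 * (4 * k - N) + p\<close>, which
  produces the factor 2. The bound on \<open>k\<close> ensures \<open>2 * k < p\<close>.\<close>

lemma jet_ramanujan_term:
  assumes "k \<le> N"
  shows "jet_cong (int p) (ramanujan_term 0 k) (ramanujan_term (of_nat p ^ 2 / 4) k)
           (2 * strange_term 0 N 0 k) (2 * strange_term 0 N (of_nat p ^ 2 / 4) k)"
proof -
  have "jet_cong (int p) (central_ratio (2 * k)) (central_ratio (2 * k))
          (of_nat (N choose (2 * k))) (of_nat (N choose (2 * k)))"
    using jet_choose[of "2 * k" 0] assms by (simp add: central_ratio_def p_eq)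
  moreover have "jet_cong (int p) (8 * of_nat k + 1) (8 * of_nat k + 1)
          (2 * (of_nat (4 * k) - of_nat N)) (2 * (of_nat (4 * k) - of_nat N))"
    by (rule jet_const[of _ _ 1]) (simp add: of_nat_p algebra_simps, (intro integral_at_intros)+)
  moreover have "k < p" using assms by (simp add: p_eq)
  ultimately have "jet_cong (int p)
      (central_ratio (2 * k) * (8 * of_nat k + 1) * ramanujan_prod 0 k)
      (central_ratio (2 * k) * (8 * of_nat k + 1) * ramanujan_prod (of_nat p ^ 2 / 4) k)
      (of_nat (N choose (2 * k)) * (2 * (of_nat (4 * k) - of_nat N)) * strange_prod 0 N 0 k)
      (of_nat (N choose (2 * k)) * (2 * (of_nat (4 * k) - of_nat N)) * strange_prod 0 N (of_nat p ^ 2 / 4) k)"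
    by (intro jet_cong_mult jet_ramanujan_prod)
  moreover have "2 * strange_term 0 N A k =
      of_nat (N choose (2 * k)) * (2 * (of_nat (4 * k) - of_nat N)) * strange_prod 0 N A k" for A
    by (simp add: strange_term_def)
  ultimately show ?thesis unfolding ramanujan_term_def by simp
qed

text \<open>Both strange sums are 0, so their increment is 0. The increment of the Ramanujan sum,
  already divisible by \<open>p^2\<close>, therefore gains another factor \<open>p\<close>.\<close>

lemma lower_half:
  obtains c where "integral_at (int p) c"
    "(\<Sum>k\<le>N. ramanujan_term (of_nat p ^ 2 / 4) k) = (\<Sum>k\<le>N. ramanujan_term 0 k) + of_nat p ^ 3 * c"
proof -
  have zero: "(\<Sum>k\<le>N. strange_term 0 N A k) = 0"
    if "\<And>i::nat. (3 * of_nat i + 5 / 2 - of_nat N)^2 \<noteq> A" for A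
    using strange_sum[of 0 N A "Suc N"] that N_mod_3 by (simp add: lessThan_Suc_atMost)
  have z0: "(\<Sum>k\<le>N. strange_term 0 N 0 k) = 0"
  proof (rule zero)
    fix i :: nat
    have "6 * i + 5 \<noteq> 2 * N" by presburger
    then have "of_nat (6 * i + 5) \<noteq> (of_nat (2 * N) :: rat)" unfolding of_nat_eq_iff .
    then show "(3 * of_nat i + 5 / 2 - of_nat N)^2 \<noteq> (0 :: rat)" by (simp add: field_simps)
  qed
  have zB: "(\<Sum>k\<le>N. strange_term 0 N (of_nat p ^ 2 / 4) k) = 0"
  proof (rule zero)
    fix i :: nat
    \<comment> \<open>Since \<open>p^2 / 4 = (N + 1/2)^2\<close>, the denominator is a difference of
      squares; its factor \<open>3 * i + 2 - 2 * N\<close> can vanish only if \<open>N\<close> is 1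
      modulo 3.\<close>
    have "3 * i + 2 \<noteq> 2 * N" using N_mod_3 by presburger
    then have 1: "of_nat (3 * i + 2) \<noteq> (of_nat (2 * N) :: rat)" unfolding of_nat_eq_iff .
    have 2: "of_nat i + 1 \<noteq> (0 :: rat)" by linarith
    have "(3 * of_nat i + 5 / 2 - of_nat N)^2 - of_nat p ^ 2 / 4
       = (of_nat (3 * i + 2) - of_nat (2 * N)) * (3 * (of_nat i + 1 :: rat))"
      by (simp add: of_nat_p power2_eq_square field_simps)
    then show "(3 * of_nat i + 5 / 2 - of_nat N)^2 \<noteq> (of_nat p ^ 2 / 4 :: rat)"
      using 1 2 by (metis eq_iff_diff_eq_0 mult_eq_0_iff zero_neq_numeral)
  qed
  have "jet_cong (int p) (\<Sum>k\<le>N. ramanujan_term 0 k) (\<Sum>k\<le>N. ramanujan_term (of_nat p ^ 2 / 4) k) 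
     (\<Sum>k\<le>N. 2 * strange_term 0 N 0 k) (\<Sum>k\<le>N. 2 * strange_term 0 N (of_nat p ^ 2 / 4) k)"
    by (intro jet_cong_sum jet_ramanujan_term) simp
  then obtain a b c where *: "integral_at (int p) c" "0 = 0 + of_int (int p) ^ 2 * b" "a - b = of_int (int p) * c"
    "(\<Sum>k\<le>N. ramanujan_term (of_nat p ^ 2 / 4) k) = (\<Sum>k\<le>N. ramanujan_term 0 k) + of_int (int p) ^ 2 * a"
    unfolding sum_distrib_left[symmetric] z0 zB mult_zero_right by (rule jet_congE) 
  have "b = 0" using *(2) p_gt by simp
  then have "a = of_nat p * c" using *(3) by simp
  with *(4) show ?thesis using *(1) that[of c] by (simp add: power2_eq_square power3_eq_cube mult.assoc)
qed

lemma upper_half_vanish: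
  assumes "k > N"
  shows "ramanujan_term (of_nat p ^ 2 / 4) k = 0"
proof -
  have "(of_nat N + 1 / 2)^2 = (of_nat p ^ 2 / 4 :: rat)"
    by (simp add: of_nat_p power2_eq_square field_simps)
  then have "ramanujan_prod (of_nat p ^ 2 / 4) k = 0"
    unfolding ramanujan_prod_def using assms by (intro prod_zero) (auto intro!: bexI[of _ N])
  then show ?thesis by (simp add: ramanujan_term_def)
qed

text \<open>The factor with index \<open>N\<close> has numerator \<open>(p / 2)^2\<close>; it is the
  source of \<open>p^2\<close> in the upper half.\<close>

lemma ramanujan_prod_0_upper:
  "ramanujan_prod 0 (N + 1 + j) = of_nat p ^ 2 * (ramanujan_prod 0 N * (1 / (2 * (3 * of_nat (N + 1)))) ^ 2) *
     (\<Prod>i<j. (of_nat (N + 1 + i) + 1 / 2)^2 / (9 * (of_nat (N + 1 + i) + 1)^2))"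
proof (induction j)
  case 0
  have "ramanujan_prod 0 (N + 1) = ramanujan_prod 0 N * ((of_nat N + 1 / 2)^2 / (9 * (of_nat N + 1)^2))"
    by (simp add: ramanujan_prod_def)
  also have "(of_nat N + 1 / 2)^2 = (of_nat p ^ 2 / 4 :: rat)"
    by (simp add: of_nat_p power2_eq_square field_simps)
  also have "of_nat p ^ 2 / 4 / (9 * (of_nat N + 1)^2) = (of_nat p ^ 2 * (1 / (2 * (3 * of_nat (N + 1)))) ^ 2 :: rat)"
    unfolding power_divide power_mult_distrib by (simp add: add.commute)
  finally show ?case by simp
next
  case (Suc j)
  have "ramanujan_prod 0 (N + 1 + Suc j) = ramanujan_prod 0 (N + 1 + j) *
     ((of_nat (N + 1 + j) + 1 / 2)^2 / (9 * (of_nat (N + 1 + j) + 1)^2))"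
    by (simp add: ramanujan_prod_def)
  then show ?case unfolding Suc by (simp only: prod.lessThan_Suc mult.assoc)
qed

text \<open>After the common factor \<open>p^2 * E\<close> is removed, one more \<open>p\<close> is
  required, so congruence modulo \<open>p\<close> to the odd-index strange sum suffices.\<close>

lemma upper_half:
  obtains c where "integral_at (int p) c" "(\<Sum>j<N. ramanujan_term 0 (N + 1 + j)) = of_nat p ^ 3 * c"
proof -
  define f where "f j = (\<Prod>i<2*j+1. (2 * (of_nat (p * 1) + of_nat i) + 1) / (2 * (of_nat (p * 1) + of_nat i + 1 :: rat)))" for j
  define g where "g j = (\<Prod>i<j. (of_nat (N + 1 + i) + 1 / 2)^2 / (9 * (of_nat (N + 1 + i) + 1 :: rat)^2))" for j
  define h where "h j = f j * (8 * of_nat (N + 1 + j) + 1) * g j" for j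
  define E where "E = central_ratio p * (ramanujan_prod 0 N * (1 / (2 * (3 * of_nat (N + 1)))) ^ 2)"
  have E: "integral_at (int p) E"
  proof -
    have "unit_at (int p) (2 * (3 * of_nat (N + 1)))"
      using p_gt by (intro unit_at_mult unit_numeral unit_lt) (auto simp: p_eq)
    then show ?thesis unfolding E_def
      by (intro integral_at_intros integral_central_ratio integral_ramanujan_prod_0) (simp add: unit_at_def)
  qed
  have term_eq: "ramanujan_term 0 (N + 1 + j) = of_nat p ^ 2 * E * h j" for j
  proof -
    \<comment> \<open>As \<open>2 * (N + 1) = p + 1\<close>, the index is
      \<open>p + (2 * j + 1)\<close>: this is why the odd binomial indices, \<open>e = 1\<close>,
      appear.\<close>
    have "central_ratio (2 * (N + 1 + j)) = central_ratio (p + (2 * j + 1))"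
      by (simp add: p_eq algebra_simps)
    also have "\<dots> = central_ratio p * f j" unfolding central_ratio_add f_def by simp
    finally show ?thesis
      unfolding ramanujan_term_def ramanujan_prod_0_upper g_def[symmetric] h_def E_def by (simp add: mult_ac)
  qed
  \<comment> \<open>All quantities are taken at \<open>A = 0\<close>, so the relation only expresses
    congruence modulo \<open>p\<close>. The minus sign is \<open>(-1)^(2j+1)\<close>; the witnesses
    5, \<open>1 / 2\<close> and 2 below are the differences of corresponding factors divided by
    \<open>p\<close>.\<close>
  have jet: "jet_cong (int p) (h j) (h j) (-2 * strange_term 1 N 0 j) (-2 * strange_term 1 N 0 j)" if j: "j < N" for j
  proof -
    have f: "jet_cong (int p) (f j) (f j) (- of_nat (N choose (2*j+1))) (- of_nat (N choose (2*j+1)))"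
      using jet_choose[of "2*j+1" 1] j unfolding f_def by (simp add: p_eq)
    have l: "jet_cong (int p) (8 * of_nat (N + 1 + j) + 1) (8 * of_nat (N + 1 + j) + 1)
       (2 * (of_nat (4*j+2*1) - of_nat N)) (2 * (of_nat (4*j+2*1) - of_nat N))"
      by (rule jet_const[of _ _ 5]) (simp add: of_nat_p algebra_simps, (intro integral_at_intros)+)
    have "jet_cong (int p) (g j) (g j) (strange_prod 1 N 0 j) (strange_prod 1 N 0 j)"
      unfolding g_def strange_prod_def
    proof (rule jet_cong_prod, rule jet_cong_divide[OF _ _ _ p_gt_1])
      fix i assume "i \<in> {..<j}"
      then have i: "N + 1 + i + 1 < p" using j by (simp add: p_eq)
      have *: "integral_at (int p) (of_nat (N + 1 + i) + 1 / 2)"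
        by (intro integral_at_intros integral_half)
      have "jet_cong (int p) (of_nat (N + 1 + i) + 1 / 2) (of_nat (N + 1 + i) + 1 / 2)
         (of_nat i + (1 + of_nat 1) / 2) (of_nat i + (1 + of_nat 1) / 2)"
      proof (rule jet_const[of _ _ "1 / 2"])
        have "integral_at (int p) (of_nat i + 1)" by (intro integral_at_intros)
        then show "integral_at (int p) (of_nat i + (1 + of_nat 1) / 2)" by simp
      qed (use * integral_half in \<open>simp_all add: of_nat_p field_simps\<close>)
      from jet_cong_mult[OF this this]
      show "jet_cong (int p) ((of_nat (N + 1 + i) + 1 / 2)^2) ((of_nat (N + 1 + i) + 1 / 2)^2)
         ((of_nat i + (1 + of_nat 1) / 2)^2 - 0) ((of_nat i + (1 + of_nat 1) / 2)^2 - 0)"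
        by (simp add: power2_eq_square)
      have "jet_cong (int p) (3 * (of_nat (N + 1 + i) + 1)) (3 * (of_nat (N + 1 + i) + 1))
         (3 * of_nat i + (5 + 3 * of_nat 1) / 2 - of_nat N) (3 * of_nat i + (5 + 3 * of_nat 1) / 2 - of_nat N)"
      proof (rule jet_const[of _ _ 2])
        have "integral_at (int p) (3 * of_nat i + 4 - of_nat N)" by (intro integral_at_intros)
        then show "integral_at (int p) (3 * of_nat i + (5 + 3 * of_nat 1) / 2 - of_nat N)" by simp
        show "integral_at (int p) (3 * (of_nat (N + 1 + i) + 1))" by (intro integral_at_intros)
      qed (simp_all add: of_nat_p field_simps)
      from jet_cong_mult[OF this this]
      show "jet_cong (int p) (9 * (of_nat (N + 1 + i) + 1)^2) (9 * (of_nat (N + 1 + i) + 1)^2)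
         ((3 * of_nat i + (5 + 3 * of_nat 1) / 2 - of_nat N)^2 - 0) ((3 * of_nat i + (5 + 3 * of_nat 1) / 2 - of_nat N)^2 - 0)"
        by (simp add: power2_eq_square algebra_simps)
      have "unit_at (int p) ((3 * of_nat (N + 1 + i + 1))^2)"
        using i by (intro unit_at_power unit_at_mult unit_numeral unit_lt) auto
      also have "(3 * of_nat (N + 1 + i + 1))^2 = 9 * (of_nat (N + 1 + i) + 1 :: rat)^2"
        unfolding power_mult_distrib by simp
      finally show "unit_at (int p) (9 * (of_nat (N + 1 + i) + 1)^2)" .
    qed
    from jet_cong_mult[OF jet_cong_mult[OF f l] this]
    have "jet_cong (int p) (h j) (h j)
        (- of_nat (N choose (2*j+1)) * (2 * (of_nat (4*j+2*1) - of_nat N)) * strange_prod 1 N 0 j)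
        (- of_nat (N choose (2*j+1)) * (2 * (of_nat (4*j+2*1) - of_nat N)) * strange_prod 1 N 0 j)"
      unfolding h_def .
    moreover have "-2 * strange_term 1 N 0 j =
        - of_nat (N choose (2*j+1)) * (2 * (of_nat (4*j+2*1) - of_nat N)) * strange_prod 1 N 0 j"
      by (simp add: strange_term_def)
    ultimately show ?thesis by simp
  qed
  have "(\<Sum>j<N. strange_term 1 N 0 j) = 0"
  proof (rule strange_sum)
    fix i :: nat
    have "3 * i + 4 \<noteq> N" using N_mod_3 by presburger
    then have "of_nat (3 * i + 4) \<noteq> (of_nat N :: rat)" unfolding of_nat_eq_iff .
    then show "(3 * of_nat i + (5 + 3 * of_nat 1) / 2 - of_nat N)^2 \<noteq> (0 :: rat)" by simp
  qed (use N_mod_3 p_gt in \<open>auto simp: p_eq\<close>)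
  then have zero: "(\<Sum>j<N. -2 * strange_term 1 N 0 j) = 0" unfolding sum_distrib_left[symmetric] by simp
  have "jet_cong (int p) (\<Sum>j<N. h j) (\<Sum>j<N. h j) (\<Sum>j<N. -2 * strange_term 1 N 0 j) (\<Sum>j<N. -2 * strange_term 1 N 0 j)"
    by (intro jet_cong_sum jet) simp
  then obtain d where d: "integral_at (int p) d" "(\<Sum>j<N. h j) = of_nat p * d"
    unfolding zero by (rule jet_congE) simp
  have "(\<Sum>j<N. ramanujan_term 0 (N + 1 + j)) = of_nat p ^ 3 * (E * d)"
    unfolding term_eq sum_distrib_left[symmetric] d(2) by (simp add: power2_eq_square power3_eq_cube mult_ac)
  then show ?thesis using that E d(1) by blast
qed

text \<open>Going from \<open>A = p^2/4\<close>, where the sum is exactly \<open>p (-3/p)\<close>,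
  to \<open>A = 0\<close> changes the lower half by \<open>- p^3 * c\<close> and the upper half from
  0 to \<open>p^3 * d\<close>.\<close>

lemma ramanujan_supercongruence:
  "rat_cong (\<Sum>k=0..p-1. ramanujan_term 0 k) (of_nat p * of_int (Legendre (-3) (int p))) (int p ^ 3)"
proof -
  define L where "L = (of_int (Legendre (-3) (int p)) :: rat)"
  have split: "(\<Sum>k=0..p-1. F k) = (\<Sum>k\<le>N. F k) + (\<Sum>j<N. F (N + 1 + j))" for F :: "nat \<Rightarrow> rat"
  proof -
    have "(\<Sum>k=0..p-1. F k) = (\<Sum>k<(N + 1) + N. F k)"
      by (intro sum.cong) (auto simp: p_eq)
    also have "(\<Sum>k<(N + 1) + M. F k) = (\<Sum>k<N+1. F k) + (\<Sum>j<M. F (N + 1 + j))" for M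
      by (induction M) (simp_all add: add.assoc)
    finally show ?thesis by (simp add: lessThan_Suc_atMost)
  qed
  have exact: "(\<Sum>k=0..p-1. ramanujan_term (of_nat p ^ 2 / 4) k) = of_nat p * L"
  proof -
    have "{0..p-1} = {..<p}" using p_gt by auto
    moreover have "(\<Sum>k<p. ramanujan_term (of_nat p ^ 2 / 4) k) = of_nat p * L"
    proof (cases "p mod 3 = 1")
      case True
      define m where "m = p div 6"
      \<comment> \<open>Oddness of \<open>p\<close> rules out the residue 4 modulo 6.\<close>
      have m: "p = 6 * m + 1" using True p_eq unfolding m_def by presburger
      then show ?thesis using ramanujan_sum_1_mod_6[of m p] Legendre_minus_3[OF prime p_gt] True
        by (simp add: L_def)
    next
      case False
      define m where "m = p div 6"
      have m: "p = 6 * m + 5" using False p_eq N_mod_3 unfolding m_def by presburger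
      then show ?thesis using ramanujan_sum_5_mod_6[of m p] Legendre_minus_3[OF prime p_gt] False
        by (simp add: L_def)
    qed
    ultimately show ?thesis by simp
  qed
  obtain c where c: "integral_at (int p) c"
    "(\<Sum>k\<le>N. ramanujan_term (of_nat p ^ 2 / 4) k) = (\<Sum>k\<le>N. ramanujan_term 0 k) + of_nat p ^ 3 * c"
    by (rule lower_half)
  obtain d where d: "integral_at (int p) d" "(\<Sum>j<N. ramanujan_term 0 (N + 1 + j)) = of_nat p ^ 3 * d"
    by (rule upper_half)
  have "(\<Sum>k=0..p-1. ramanujan_term 0 k) - of_nat p * L = of_int (int p ^ 3) * (d - c)"
    unfolding exact[symmetric] split using c(2) d(2) upper_half_vanish by (simp add: algebra_simps)
  moreover have "integral_at (int p) (d - c)" using c d by auto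
  moreover have "integral_at (int p) (\<Sum>k=0..p-1. ramanujan_term 0 k)"
    by (intro integral_at_sum integral_ramanujan_term_0)
  moreover have "integral_at (int p) (of_nat p * L)" unfolding L_def by (intro integral_at_intros)
  ultimately show ?thesis unfolding rat_cong_def L_def by (auto simp: integral_at_power)
qed

end

theorem theorem2:
  fixes p :: nat
  assumes "prime p" and "p > 3"
  shows "rat_cong
           (\<Sum>k=0..p-1. pochhammer (1/4) k * pochhammer (1/2) k * pochhammer (3/4) k
                          / (fact k ^ 3 * 9 ^ k) * of_nat (8 * k + 1))
           (of_nat p * of_int (Legendre (-3) (int p)))
           (int p ^ 3)
       \<and> rat_cong
           (\<Sum>k=0..p-1. of_nat (((4 * k) choose (2 * k)) * ((2 * k) choose k) ^ 2)
                          / (2 ^ (8 * k) * 3 ^ (2 * k)) * of_nat (8 * k + 1))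
           (of_nat p * of_int (Legendre (-3) (int p)))
           (int p ^ 3)"
proof -
  have "odd p" using assms prime_odd_nat by force
  then obtain N where "p = 2 * N + 1" by (rule oddE)
  from ramanujan_supercongruence[OF assms this] show ?thesis
    unfolding ramanujan_term_0_pochhammer ramanujan_term_0_choose by simp
qed

end
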